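(* Let $\mathcal{T}$ be a triangulated category and $\mathcal{X}$ a contravariantly finite rigid subcategory of $\mathcal{T}$. If $\mathcal{X}^{\bot}$ is contravariantly finite in $\mathcal{T}$, then the stable category $\mathcal{T}/\mathcal{X}^{\bot}$ is semi-abelian and integral.
   Context: $\mathcal{T}$ has split idempotents and shift $[1]$; subcategories are full, additive, closed under isomorphisms and direct summands. $\mathcal{X}$ is contravariantly finite if every $A\in\mathcal{T}$ admits a map $X_A\to A$, $X_A\in\mathcal{X}$, with $\mathcal{T}(\mathcal{X},X_A)\to\mathcal{T}(\mathcal{X},A)$ surjective. $\mathcal{X}$ is rigid if $\mathcal{T}(\mathcal{X},\mathcal{X}[1])=0$. $\mathcal{X}^{\bot}=\{A\mid\mathcal{T}(\mathcal{X},A)=0\}$. $\mathcal{T}/\mathcal{X}^{\bot}$ has the objects of $\mathcal{T}$ and morphisms those of $\mathcal{T}$ modulo maps factoring through an object of $\mathcal{X}^{\bot}$. An additive category is preabelian if it has kernels and cokernels. A preabelian category is integral if epimorphisms are stable under pull-backs and monomorphisms are stable under push-outs; it is semiabelian if for every map $f$ the canonical map $\mathrm{Coker}(\ker f)\to\mathrm{Ker}(\mathrm{coker} f)$ is regular, i.e. both a monomorphism and an epimorphism. *)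

theory Defs
  imports "HOL-Algebra.Group"
begin

section \<open>Preadditive and additive categories\<close>

text \<open>
  A category is given by a set of objects and pairwise disjoint Hom-sets inside one type of
  morphisms, so that source and target of a morphism are determined by the morphism.
  The composite \<open>g \<cdot> f\<close> means ``first \<open>f\<close>, then \<open>g\<close>''.
  The addition \<open>\<boxplus>\<close> and the zero morphisms are part of the data.
  Everything is meaningful only for objects in \<open>Ob\<close> and composable (parallel) morphisms.
\<close>

record ('o, 'm) cat =
  Ob :: "'o set"
  Hom :: "'o \<Rightarrow> 'o \<Rightarrow> 'm set"
  Ident :: "'o \<Rightarrow> 'm"
  Cmp :: "'m \<Rightarrow> 'm \<Rightarrow> 'm" (infixl "\<cdot>\<index>" 70)
  Add :: "'m \<Rightarrow> 'm \<Rightarrow> 'm" (infixl "\<boxplus>\<index>" 65)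
  Nul :: "'o \<Rightarrow> 'o \<Rightarrow> 'm"

definition hom_group :: "('o, 'm, 'x) cat_scheme \<Rightarrow> 'o \<Rightarrow> 'o \<Rightarrow> 'm monoid" where
  "hom_group C A B = \<lparr>carrier = Hom C A B, mult = Add C, one = Nul C A B\<rparr>"

locale category =
  fixes C :: "('o, 'm, 'x) cat_scheme" (structure)
  assumes hom_disjoint:
      "\<lbrakk>A \<in> Ob C; B \<in> Ob C; A' \<in> Ob C; B' \<in> Ob C; f \<in> Hom C A B; f \<in> Hom C A' B'\<rbrakk>
        \<Longrightarrow> A = A' \<and> B = B'"
    and ident_in_hom: "A \<in> Ob C \<Longrightarrow> Ident C A \<in> Hom C A A"
    and cmp_in_hom:
      "\<lbrakk>A \<in> Ob C; B \<in> Ob C; D \<in> Ob C; f \<in> Hom C A B; g \<in> Hom C B D\<rbrakk> \<Longrightarrow> g \<cdot> f \<in> Hom C A D"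
    and ident_left: "\<lbrakk>A \<in> Ob C; B \<in> Ob C; f \<in> Hom C A B\<rbrakk> \<Longrightarrow> Ident C B \<cdot> f = f"
    and ident_right: "\<lbrakk>A \<in> Ob C; B \<in> Ob C; f \<in> Hom C A B\<rbrakk> \<Longrightarrow> f \<cdot> Ident C A = f"
    and cmp_assoc:
      "\<lbrakk>A \<in> Ob C; B \<in> Ob C; D \<in> Ob C; E \<in> Ob C;
        f \<in> Hom C A B; g \<in> Hom C B D; h \<in> Hom C D E\<rbrakk> \<Longrightarrow> (h \<cdot> g) \<cdot> f = h \<cdot> (g \<cdot> f)"

locale preadditive_category = category +
  assumes hom_comm_group: "\<lbrakk>A \<in> Ob C; B \<in> Ob C\<rbrakk> \<Longrightarrow> comm_group (hom_group C A B)"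
    and cmp_add_left:
      "\<lbrakk>A \<in> Ob C; B \<in> Ob C; D \<in> Ob C; f \<in> Hom C A B; g \<in> Hom C B D; g' \<in> Hom C B D\<rbrakk>
        \<Longrightarrow> (g \<boxplus> g') \<cdot> f = (g \<cdot> f) \<boxplus> (g' \<cdot> f)"
    and cmp_add_right:
      "\<lbrakk>A \<in> Ob C; B \<in> Ob C; D \<in> Ob C; f \<in> Hom C A B; f' \<in> Hom C A B; g \<in> Hom C B D\<rbrakk>
        \<Longrightarrow> g \<cdot> (f \<boxplus> f') = (g \<cdot> f) \<boxplus> (g \<cdot> f')"

definition zero_object :: "('o, 'm, 'x) cat_scheme \<Rightarrow> 'o \<Rightarrow> bool" where
  "zero_object C Z \<longleftrightarrow> Z \<in> Ob C \<and>
    (\<forall>A\<in>Ob C. (\<exists>!f. f \<in> Hom C Z A) \<and> (\<exists>!f. f \<in> Hom C A Z))"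

definition biproduct ::
  "('o, 'm, 'x) cat_scheme \<Rightarrow> 'o \<Rightarrow> 'o \<Rightarrow> 'o \<Rightarrow> 'm \<Rightarrow> 'm \<Rightarrow> 'm \<Rightarrow> 'm \<Rightarrow> bool" where
  "biproduct C A B S i j p q \<longleftrightarrow> A \<in> Ob C \<and> B \<in> Ob C \<and> S \<in> Ob C \<and>
    i \<in> Hom C A S \<and> j \<in> Hom C B S \<and> p \<in> Hom C S A \<and> q \<in> Hom C S B \<and>
    p \<cdot>\<^bsub>C\<^esub> i = Ident C A \<and> q \<cdot>\<^bsub>C\<^esub> j = Ident C B \<and>
    q \<cdot>\<^bsub>C\<^esub> i = Nul C A B \<and> p \<cdot>\<^bsub>C\<^esub> j = Nul C B A \<and>
    (i \<cdot>\<^bsub>C\<^esub> p) \<boxplus>\<^bsub>C\<^esub> (j \<cdot>\<^bsub>C\<^esub> q) = Ident C S"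

definition is_direct_sum :: "('o, 'm, 'x) cat_scheme \<Rightarrow> 'o \<Rightarrow> 'o \<Rightarrow> 'o \<Rightarrow> bool" where
  "is_direct_sum C A B S \<longleftrightarrow> (\<exists>i j p q. biproduct C A B S i j p q)"

locale additive_category = preadditive_category +
  assumes ex_zero_object: "\<exists>Z. zero_object C Z"
    and ex_direct_sum: "\<lbrakk>A \<in> Ob C; B \<in> Ob C\<rbrakk> \<Longrightarrow> \<exists>S. is_direct_sum C A B S"


section \<open>Preabelian, semiabelian and integral categories\<close>

definition isomorphism :: "('o, 'm, 'x) cat_scheme \<Rightarrow> 'o \<Rightarrow> 'o \<Rightarrow> 'm \<Rightarrow> bool" where
  "isomorphism C A B f \<longleftrightarrow> A \<in> Ob C \<and> B \<in> Ob C \<and> f \<in> Hom C A B \<and>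
    (\<exists>g\<in>Hom C B A. g \<cdot>\<^bsub>C\<^esub> f = Ident C A \<and> f \<cdot>\<^bsub>C\<^esub> g = Ident C B)"

definition monomorphism :: "('o, 'm, 'x) cat_scheme \<Rightarrow> 'o \<Rightarrow> 'o \<Rightarrow> 'm \<Rightarrow> bool" where
  "monomorphism C A B f \<longleftrightarrow> A \<in> Ob C \<and> B \<in> Ob C \<and> f \<in> Hom C A B \<and>
    (\<forall>W\<in>Ob C. \<forall>g\<in>Hom C W A. \<forall>h\<in>Hom C W A. f \<cdot>\<^bsub>C\<^esub> g = f \<cdot>\<^bsub>C\<^esub> h \<longrightarrow> g = h)"

definition epimorphism :: "('o, 'm, 'x) cat_scheme \<Rightarrow> 'o \<Rightarrow> 'o \<Rightarrow> 'm \<Rightarrow> bool" where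
  "epimorphism C A B f \<longleftrightarrow> A \<in> Ob C \<and> B \<in> Ob C \<and> f \<in> Hom C A B \<and>
    (\<forall>W\<in>Ob C. \<forall>g\<in>Hom C B W. \<forall>h\<in>Hom C B W. g \<cdot>\<^bsub>C\<^esub> f = h \<cdot>\<^bsub>C\<^esub> f \<longrightarrow> g = h)"

definition regular_morphism :: "('o, 'm, 'x) cat_scheme \<Rightarrow> 'o \<Rightarrow> 'o \<Rightarrow> 'm \<Rightarrow> bool" where
  "regular_morphism C A B f \<longleftrightarrow> monomorphism C A B f \<and> epimorphism C A B f"

text \<open>\<open>is_kernel C A B f K k\<close>: the morphism \<open>k : K \<rightarrow> A\<close> is a kernel of \<open>f : A \<rightarrow> B\<close>;
  \<open>is_cokernel C A B f Q c\<close>: the morphism \<open>c : B \<rightarrow> Q\<close> is a cokernel of \<open>f : A \<rightarrow> B\<close>.\<close>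

definition is_kernel ::
  "('o, 'm, 'x) cat_scheme \<Rightarrow> 'o \<Rightarrow> 'o \<Rightarrow> 'm \<Rightarrow> 'o \<Rightarrow> 'm \<Rightarrow> bool" where
  "is_kernel C A B f K k \<longleftrightarrow> A \<in> Ob C \<and> B \<in> Ob C \<and> K \<in> Ob C \<and>
    f \<in> Hom C A B \<and> k \<in> Hom C K A \<and> f \<cdot>\<^bsub>C\<^esub> k = Nul C K B \<and>
    (\<forall>W\<in>Ob C. \<forall>g\<in>Hom C W A. f \<cdot>\<^bsub>C\<^esub> g = Nul C W B \<longrightarrow>
      (\<exists>!h. h \<in> Hom C W K \<and> k \<cdot>\<^bsub>C\<^esub> h = g))"

definition is_cokernel ::
  "('o, 'm, 'x) cat_scheme \<Rightarrow> 'o \<Rightarrow> 'o \<Rightarrow> 'm \<Rightarrow> 'o \<Rightarrow> 'm \<Rightarrow> bool" where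
  "is_cokernel C A B f Q c \<longleftrightarrow> A \<in> Ob C \<and> B \<in> Ob C \<and> Q \<in> Ob C \<and>
    f \<in> Hom C A B \<and> c \<in> Hom C B Q \<and> c \<cdot>\<^bsub>C\<^esub> f = Nul C A Q \<and>
    (\<forall>W\<in>Ob C. \<forall>g\<in>Hom C B W. g \<cdot>\<^bsub>C\<^esub> f = Nul C A W \<longrightarrow>
      (\<exists>!h. h \<in> Hom C Q W \<and> h \<cdot>\<^bsub>C\<^esub> c = g))"

locale preabelian_category = additive_category +
  assumes ex_kernel: "\<lbrakk>A \<in> Ob C; B \<in> Ob C; f \<in> Hom C A B\<rbrakk> \<Longrightarrow> \<exists>K k. is_kernel C A B f K k"
    and ex_cokernel: "\<lbrakk>A \<in> Ob C; B \<in> Ob C; f \<in> Hom C A B\<rbrakk> \<Longrightarrow> \<exists>Q c. is_cokernel C A B f Q c"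

text \<open>For \<open>f : A \<rightarrow> B\<close> with kernel \<open>k\<close> and cokernel \<open>c\<close>, let \<open>p : A \<rightarrow> I\<close> be a cokernel of \<open>k\<close>
  and \<open>j : J \<rightarrow> B\<close> a kernel of \<open>c\<close>.  The canonical map is the morphism \<open>h : I \<rightarrow> J\<close> with
  \<open>j \<cdot> h \<cdot> p = f\<close>; it is unique, because \<open>p\<close> is an epimorphism and \<open>j\<close> a monomorphism.\<close>

locale semiabelian_category = preabelian_category +
  assumes canonical_regular:
    "\<lbrakk>is_kernel C A B f K k; is_cokernel C K A k I p;
      is_cokernel C A B f Q c; is_kernel C B Q c J j\<rbrakk>
      \<Longrightarrow> \<exists>h\<in>Hom C I J. j \<cdot> (h \<cdot> p) = f \<and> regular_morphism C I J h"

text \<open>\<open>is_pullback C A B D f g P p q\<close>: the square \<open>f \<cdot> p = g \<cdot> q\<close> with \<open>f : A \<rightarrow> D\<close>,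
  \<open>g : B \<rightarrow> D\<close>, \<open>p : P \<rightarrow> A\<close>, \<open>q : P \<rightarrow> B\<close> is cartesian.
  \<open>is_pushout C D A B f g P p q\<close>: the square \<open>p \<cdot> f = q \<cdot> g\<close> with \<open>f : D \<rightarrow> A\<close>,
  \<open>g : D \<rightarrow> B\<close>, \<open>p : A \<rightarrow> P\<close>, \<open>q : B \<rightarrow> P\<close> is cocartesian.\<close>

definition is_pullback ::
  "('o, 'm, 'x) cat_scheme \<Rightarrow> 'o \<Rightarrow> 'o \<Rightarrow> 'o \<Rightarrow> 'm \<Rightarrow> 'm \<Rightarrow> 'o \<Rightarrow> 'm \<Rightarrow> 'm \<Rightarrow> bool" where
  "is_pullback C A B D f g P p q \<longleftrightarrow>
    A \<in> Ob C \<and> B \<in> Ob C \<and> D \<in> Ob C \<and> P \<in> Ob C \<and>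
    f \<in> Hom C A D \<and> g \<in> Hom C B D \<and> p \<in> Hom C P A \<and> q \<in> Hom C P B \<and>
    f \<cdot>\<^bsub>C\<^esub> p = g \<cdot>\<^bsub>C\<^esub> q \<and>
    (\<forall>W\<in>Ob C. \<forall>a\<in>Hom C W A. \<forall>b\<in>Hom C W B. f \<cdot>\<^bsub>C\<^esub> a = g \<cdot>\<^bsub>C\<^esub> b \<longrightarrow>
      (\<exists>!h. h \<in> Hom C W P \<and> p \<cdot>\<^bsub>C\<^esub> h = a \<and> q \<cdot>\<^bsub>C\<^esub> h = b))"

definition is_pushout ::
  "('o, 'm, 'x) cat_scheme \<Rightarrow> 'o \<Rightarrow> 'o \<Rightarrow> 'o \<Rightarrow> 'm \<Rightarrow> 'm \<Rightarrow> 'o \<Rightarrow> 'm \<Rightarrow> 'm \<Rightarrow> bool" where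
  "is_pushout C D A B f g P p q \<longleftrightarrow>
    A \<in> Ob C \<and> B \<in> Ob C \<and> D \<in> Ob C \<and> P \<in> Ob C \<and>
    f \<in> Hom C D A \<and> g \<in> Hom C D B \<and> p \<in> Hom C A P \<and> q \<in> Hom C B P \<and>
    p \<cdot>\<^bsub>C\<^esub> f = q \<cdot>\<^bsub>C\<^esub> g \<and>
    (\<forall>W\<in>Ob C. \<forall>a\<in>Hom C A W. \<forall>b\<in>Hom C B W. a \<cdot>\<^bsub>C\<^esub> f = b \<cdot>\<^bsub>C\<^esub> g \<longrightarrow>
      (\<exists>!h. h \<in> Hom C P W \<and> h \<cdot>\<^bsub>C\<^esub> p = a \<and> h \<cdot>\<^bsub>C\<^esub> q = b))"

locale integral_category = preabelian_category +
  assumes epi_pullback: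
      "\<lbrakk>is_pullback C A B D f g P p q; epimorphism C A D f\<rbrakk> \<Longrightarrow> epimorphism C P B q"
    and mono_pushout:
      "\<lbrakk>is_pushout C D A B f g P p q; monomorphism C D A f\<rbrakk> \<Longrightarrow> monomorphism C B P q"


section \<open>Triangulated categories\<close>

text \<open>\<open>Tri\<close> is the set of distinguished triangles; \<open>(u, v, w)\<close> stands for
  \<open>A \<rightarrow> B \<rightarrow> D \<rightarrow> A[1]\<close>, the objects being determined by the morphisms.\<close>

record ('o, 'm) tricat = "('o, 'm) cat" +
  Sh :: "'o \<Rightarrow> 'o"
  Shm :: "'m \<Rightarrow> 'm"
  Tri :: "('m \<times> 'm \<times> 'm) set"

definition is_triangle ::
  "('o, 'm, 'x) tricat_scheme \<Rightarrow> 'o \<Rightarrow> 'o \<Rightarrow> 'o \<Rightarrow> 'm \<Rightarrow> 'm \<Rightarrow> 'm \<Rightarrow> bool" where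
  "is_triangle C A B D u v w \<longleftrightarrow> A \<in> Ob C \<and> B \<in> Ob C \<and> D \<in> Ob C \<and>
    u \<in> Hom C A B \<and> v \<in> Hom C B D \<and> w \<in> Hom C D (Sh C A)"

definition distinguished ::
  "('o, 'm, 'x) tricat_scheme \<Rightarrow> 'o \<Rightarrow> 'o \<Rightarrow> 'o \<Rightarrow> 'm \<Rightarrow> 'm \<Rightarrow> 'm \<Rightarrow> bool" where
  "distinguished C A B D u v w \<longleftrightarrow> is_triangle C A B D u v w \<and> (u, v, w) \<in> Tri C"

text \<open>The shift is an additive auto-equivalence (fully faithful and essentially surjective);
  it need not be a strict automorphism.  The axioms are those of Verdier, including the
  octahedral axiom.\<close>

locale triangulated_category = additive_category C
  for C :: "('o, 'm, 'x) tricat_scheme" (structure) +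
  assumes shift_ob: "A \<in> Ob C \<Longrightarrow> Sh C A \<in> Ob C"
    and shift_ident: "A \<in> Ob C \<Longrightarrow> Shm C (Ident C A) = Ident C (Sh C A)"
    and shift_cmp:
      "\<lbrakk>A \<in> Ob C; B \<in> Ob C; D \<in> Ob C; f \<in> Hom C A B; g \<in> Hom C B D\<rbrakk>
        \<Longrightarrow> Shm C (g \<cdot> f) = Shm C g \<cdot> Shm C f"
    and shift_add:
      "\<lbrakk>A \<in> Ob C; B \<in> Ob C; f \<in> Hom C A B; g \<in> Hom C A B\<rbrakk>
        \<Longrightarrow> Shm C (f \<boxplus> g) = Shm C f \<boxplus> Shm C g"
    and shift_fully_faithful:
      "\<lbrakk>A \<in> Ob C; B \<in> Ob C\<rbrakk> \<Longrightarrow> bij_betw (Shm C) (Hom C A B) (Hom C (Sh C A) (Sh C B))"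
    and shift_ess_surj: "B \<in> Ob C \<Longrightarrow> \<exists>A\<in>Ob C. \<exists>f. isomorphism C (Sh C A) B f"
    and tri_iso_closed:
      "\<lbrakk>distinguished C A B D u v w; is_triangle C A' B' D' u' v' w';
        isomorphism C A A' a; isomorphism C B B' b; isomorphism C D D' d;
        b \<cdot> u = u' \<cdot> a; d \<cdot> v = v' \<cdot> b; Shm C a \<cdot> w = w' \<cdot> d\<rbrakk>
        \<Longrightarrow> distinguished C A' B' D' u' v' w'"
    and tri_ident:
      "\<lbrakk>A \<in> Ob C; zero_object C Z\<rbrakk>
        \<Longrightarrow> distinguished C A A Z (Ident C A) (Nul C A Z) (Nul C Z (Sh C A))"
    and tri_exists:
      "\<lbrakk>A \<in> Ob C; B \<in> Ob C; u \<in> Hom C A B\<rbrakk> \<Longrightarrow> \<exists>D v w. distinguished C A B D u v w"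
    and tri_rotate:
      "is_triangle C A B D u v w \<Longrightarrow>
        distinguished C A B D u v w \<longleftrightarrow>
        distinguished C B D (Sh C A) v w (inv\<^bsub>hom_group C (Sh C A) (Sh C B)\<^esub> (Shm C u))"
    and tri_morphism:
      "\<lbrakk>distinguished C A B D u v w; distinguished C A' B' D' u' v' w';
        a \<in> Hom C A A'; b \<in> Hom C B B'; b \<cdot> u = u' \<cdot> a\<rbrakk>
        \<Longrightarrow> \<exists>d\<in>Hom C D D'. d \<cdot> v = v' \<cdot> b \<and> Shm C a \<cdot> w = w' \<cdot> d"
    and octahedral:
      "\<lbrakk>distinguished C X Y Z' u i i'; distinguished C Y Z X' v j j';
        distinguished C X Z Y' (v \<cdot> u) k k'\<rbrakk>
        \<Longrightarrow> \<exists>f g. distinguished C Z' Y' X' f g (Shm C i \<cdot> j') \<and>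
              f \<cdot> i = k \<cdot> v \<and> k' \<cdot> f = i' \<and> g \<cdot> k = j \<and> j' \<cdot> g = Shm C u \<cdot> k'"

definition idempotents_split :: "('o, 'm, 'x) cat_scheme \<Rightarrow> bool" where
  "idempotents_split C \<longleftrightarrow>
    (\<forall>A\<in>Ob C. \<forall>e\<in>Hom C A A. e \<cdot>\<^bsub>C\<^esub> e = e \<longrightarrow>
      (\<exists>B\<in>Ob C. \<exists>p\<in>Hom C A B. \<exists>i\<in>Hom C B A. p \<cdot>\<^bsub>C\<^esub> i = Ident C B \<and> i \<cdot>\<^bsub>C\<^esub> p = e))"


section \<open>Subcategories and stable categories\<close>

text \<open>Full subcategories are represented by their sets of objects.\<close>

locale additive_subcategory =
  fixes C :: "('o, 'm, 'x) cat_scheme" (structure) and X :: "'o set"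
  assumes sub_ob: "X \<subseteq> Ob C"
    and sub_zero: "\<exists>Z\<in>X. zero_object C Z"
    and sub_direct_sum: "\<lbrakk>A \<in> X; B \<in> X; is_direct_sum C A B S\<rbrakk> \<Longrightarrow> S \<in> X"
    and sub_iso: "\<lbrakk>A \<in> X; isomorphism C A B f\<rbrakk> \<Longrightarrow> B \<in> X"
    and sub_summand: "\<lbrakk>S \<in> X; is_direct_sum C A B S\<rbrakk> \<Longrightarrow> A \<in> X"

definition contravariantly_finite :: "('o, 'm, 'x) cat_scheme \<Rightarrow> 'o set \<Rightarrow> bool" where
  "contravariantly_finite C X \<longleftrightarrow>
    (\<forall>A\<in>Ob C. \<exists>X\<^sub>A\<in>X. \<exists>f\<in>Hom C X\<^sub>A A.
      \<forall>X'\<in>X. (\<lambda>h. f \<cdot>\<^bsub>C\<^esub> h) ` Hom C X' X\<^sub>A = Hom C X' A)"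

definition rigid :: "('o, 'm, 'x) tricat_scheme \<Rightarrow> 'o set \<Rightarrow> bool" where
  "rigid C X \<longleftrightarrow> (\<forall>A\<in>X. \<forall>B\<in>X. Hom C A (Sh C B) = {Nul C A (Sh C B)})"

definition right_perp :: "('o, 'm, 'x) cat_scheme \<Rightarrow> 'o set \<Rightarrow> 'o set" where
  "right_perp C X = {A \<in> Ob C. \<forall>B\<in>X. Hom C B A = {Nul C B A}}"

definition factoring_maps :: "('o, 'm, 'x) cat_scheme \<Rightarrow> 'o set \<Rightarrow> 'o \<Rightarrow> 'o \<Rightarrow> 'm set" where
  "factoring_maps C Y A B = {b \<cdot>\<^bsub>C\<^esub> a | a b W. W \<in> Y \<and> a \<in> Hom C A W \<and> b \<in> Hom C W B}"

text \<open>Two morphisms are identified if they are parallel and their difference factors through an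
  object of \<open>Y\<close>.  For an additive subcategory \<open>Y\<close> this is a congruence.\<close>

definition stable_rel :: "('o, 'm, 'x) cat_scheme \<Rightarrow> 'o set \<Rightarrow> ('m \<times> 'm) set" where
  "stable_rel C Y = {(f, g). \<exists>A\<in>Ob C. \<exists>B\<in>Ob C. f \<in> Hom C A B \<and> g \<in> Hom C A B \<and>
    (\<exists>h\<in>factoring_maps C Y A B. f = g \<boxplus>\<^bsub>C\<^esub> h)}"

text \<open>The category \<open>C/Y\<close>: morphisms are equivalence classes, and the operations are induced by
  those on representatives.\<close>

definition stable_category ::
  "('o, 'm, 'x) cat_scheme \<Rightarrow> 'o set \<Rightarrow> ('o, 'm set) cat" where
  "stable_category C Y = \<lparr>
    Ob = Ob C,
    Hom = (\<lambda>A B. Hom C A B // stable_rel C Y),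
    Ident = (\<lambda>A. stable_rel C Y `` {Ident C A}),
    Cmp = (\<lambda>G F. stable_rel C Y `` {g \<cdot>\<^bsub>C\<^esub> f | g f. g \<in> G \<and> f \<in> F}),
    Add = (\<lambda>F G. stable_rel C Y `` {f \<boxplus>\<^bsub>C\<^esub> g | f g. f \<in> F \<and> g \<in> G}),
    Nul = (\<lambda>A B. stable_rel C Y `` {Nul C A B})\<rparr>"

end

theory Submission
  imports Defs
begin

text \<open>
  Let \<open>F = \<T>(\<X>, -)\<close>.  The cone of a right \<open>\<X>\<close>-approximation lies in
  \<open>\<X>\<^sup>\<bottom>\<close> by rigidity, so a map factors through \<open>\<X>\<^sup>\<bottom>\<close> if and only
  if \<open>F\<close> kills it, and \<open>F\<close> is faithful on the stable category.  The cokernel of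
  \<open>f : A \<rightarrow> B\<close> is the cone of the composite of \<open>f\<close> with a right
  \<open>\<X>\<close>-approximation of \<open>A\<close>, and \<open>F\<close> preserves it.  A weak kernel of \<open>f\<close> is
  obtained from the fibre of \<open>(f, y) : A \<oplus> Y \<rightarrow> B\<close>, where \<open>y\<close> is a right
  \<open>\<X>\<^sup>\<bottom>\<close>-approximation of \<open>B\<close>, and the coimage of a weak kernel is a kernel.
  Hence \<open>F\<close> preserves kernels and cokernels and detects monomorphisms and epimorphisms as
  injections and surjections, which reduces both claims to the corresponding facts about abelian
  groups.
\<close>

section \<open>Calculus in preadditive categories\<close>

context category
begin

text \<open>Because Hom-sets are disjoint, a morphism determines its two objects. With
  \<open>arr\<close>, \<open>src\<close> and \<open>tgt\<close> all typing conditions become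
  equations that simplification can discharge.\<close>

definition arr :: "'m \<Rightarrow> bool" where
  "arr f \<longleftrightarrow> (\<exists>A\<in>Ob C. \<exists>B\<in>Ob C. f \<in> Hom C A B)"

definition src :: "'m \<Rightarrow> 'o" where
  "src f = (THE A. A \<in> Ob C \<and> (\<exists>B\<in>Ob C. f \<in> Hom C A B))"

definition tgt :: "'m \<Rightarrow> 'o" where
  "tgt f = (THE B. B \<in> Ob C \<and> (\<exists>A\<in>Ob C. f \<in> Hom C A B))"

lemma hom_iff [simp]:
  assumes "A \<in> Ob C" "B \<in> Ob C"
  shows "f \<in> Hom C A B \<longleftrightarrow> arr f \<and> src f = A \<and> tgt f = B"
proof -
  have *: "src f = A \<and> tgt f = B" if "A \<in> Ob C" "B \<in> Ob C" "f \<in> Hom C A B" for A B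
    unfolding src_def tgt_def using that hom_disjoint by (auto intro!: the_equality)
  show ?thesis
    unfolding arr_def using * assms by blast
qed

lemma arr_ob [simp]: "arr f \<Longrightarrow> src f \<in> Ob C" "arr f \<Longrightarrow> tgt f \<in> Ob C"
  by (metis arr_def hom_iff)+

lemma arr_ident [simp]:
  assumes "A \<in> Ob C"
  shows "arr (Ident C A)" "src (Ident C A) = A" "tgt (Ident C A) = A"
  using ident_in_hom [OF assms] assms by auto

lemma arr_cmp [simp]:
  assumes "arr f" "arr g" "tgt f = src g"
  shows "arr (g \<cdot> f)" "src (g \<cdot> f) = src f" "tgt (g \<cdot> f) = tgt g"
  using cmp_in_hom [of "src f" "tgt f" "tgt g" f g] assms by auto

lemma cmp_ident [simp]:
  "arr f \<Longrightarrow> tgt f = B \<Longrightarrow> Ident C B \<cdot> f = f"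
  "arr f \<Longrightarrow> src f = A \<Longrightarrow> f \<cdot> Ident C A = f"
  using ident_left ident_right by auto

lemma assoc [simp]:
  "arr f \<Longrightarrow> arr g \<Longrightarrow> arr h \<Longrightarrow> tgt f = src g \<Longrightarrow> tgt g = src h \<Longrightarrow>
    (h \<cdot> g) \<cdot> f = h \<cdot> (g \<cdot> f)"
  using cmp_assoc [of "src f" "tgt f" "tgt g" "tgt h" f g h] by simp

text \<open>Right bracketing hides the factor \<open>k \<cdot> g\<close> inside
  \<open>k \<cdot> (g \<cdot> f)\<close>. This form lets a known value of that factor be used there
  without undoing the normal form.\<close>

lemma assoc_eq:
  "k \<cdot> g = t \<Longrightarrow> arr f \<Longrightarrow> arr g \<Longrightarrow> arr k \<Longrightarrow> tgt f = src g \<Longrightarrow> tgt g = src k \<Longrightarrow>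
    k \<cdot> (g \<cdot> f) = t \<cdot> f"
  by auto

end

section \<open>Arithmetic in the Hom-groups\<close>

context preadditive_category
begin

definition neg where
  "neg f = inv\<^bsub>hom_group C (src f) (tgt f)\<^esub> f"

lemma arr_nul [simp]:
  assumes "A \<in> Ob C" "B \<in> Ob C"
  shows "arr (Nul C A B)" "src (Nul C A B) = A" "tgt (Nul C A B) = B"
proof -
  interpret G: comm_group "hom_group C A B" using assms by (rule hom_comm_group)
  show "arr (Nul C A B)" "src (Nul C A B) = A" "tgt (Nul C A B) = B"
    using G.one_closed assms by (auto simp: hom_group_def)
qed

lemma arr_add [simp]:
  assumes "arr f" "arr g" "src f = src g" "tgt f = tgt g"
  shows "arr (f \<boxplus> g)" "src (f \<boxplus> g) = src g" "tgt (f \<boxplus> g) = tgt g"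
proof -
  interpret G: comm_group "hom_group C (src g) (tgt g)" using assms by (intro hom_comm_group) auto
  show "arr (f \<boxplus> g)" "src (f \<boxplus> g) = src g" "tgt (f \<boxplus> g) = tgt g"
    using G.m_closed [of f g] assms by (auto simp: hom_group_def)
qed

lemma arr_neg [simp]:
  assumes "arr f"
  shows "arr (neg f)" "src (neg f) = src f" "tgt (neg f) = tgt f"
proof -
  interpret G: comm_group "hom_group C (src f) (tgt f)" using assms by (intro hom_comm_group) auto
  show "arr (neg f)" "src (neg f) = src f" "tgt (neg f) = tgt f"
    using G.inv_closed [of f] assms unfolding neg_def by (auto simp: hom_group_def)
qed

lemma add_assoc [simp]:
  assumes "arr f" "arr g" "arr h" "src f = src g" "tgt f = tgt g" "src g = src h" "tgt g = tgt h"
  shows "(f \<boxplus> g) \<boxplus> h = f \<boxplus> (g \<boxplus> h)"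
proof -
  interpret G: comm_group "hom_group C (src h) (tgt h)" using assms by (intro hom_comm_group) auto
  show ?thesis using G.m_assoc [of f g h] assms by (auto simp: hom_group_def)
qed

lemma add_commute:
  assumes "arr f" "arr g" "src f = src g" "tgt f = tgt g"
  shows "f \<boxplus> g = g \<boxplus> f"
proof -
  interpret G: comm_group "hom_group C (src g) (tgt g)" using assms by (intro hom_comm_group) auto
  show ?thesis using G.m_comm [of f g] assms by (auto simp: hom_group_def)
qed

lemma add_left_commute:
  assumes "arr f" "arr g" "arr h" "src f = src g" "tgt f = tgt g" "src g = src h" "tgt g = tgt h"
  shows "f \<boxplus> (g \<boxplus> h) = g \<boxplus> (f \<boxplus> h)"
proof -
  interpret G: comm_group "hom_group C (src h) (tgt h)" using assms by (intro hom_comm_group) auto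
  show ?thesis using G.m_lcomm [of f g h] assms by (auto simp: hom_group_def)
qed

lemma add_nul [simp]:
  assumes "arr f" "src f = A" "tgt f = B"
  shows "f \<boxplus> Nul C A B = f" "Nul C A B \<boxplus> f = f"
proof -
  interpret G: comm_group "hom_group C A B" using assms by (intro hom_comm_group) auto
  show "f \<boxplus> Nul C A B = f" "Nul C A B \<boxplus> f = f"
    using G.r_one [of f] G.l_one [of f] assms by (auto simp: hom_group_def)
qed

lemma add_neg [simp]:
  assumes "arr f"
  shows "f \<boxplus> neg f = Nul C (src f) (tgt f)" "neg f \<boxplus> f = Nul C (src f) (tgt f)"
proof -
  interpret G: comm_group "hom_group C (src f) (tgt f)" using assms by (intro hom_comm_group) auto
  show "f \<boxplus> neg f = Nul C (src f) (tgt f)" "neg f \<boxplus> f = Nul C (src f) (tgt f)"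
    using G.r_inv [of f] G.l_inv [of f] assms unfolding neg_def by (auto simp: hom_group_def)
qed

lemma add_neg_cancel [simp]:
  assumes "arr f" "arr g" "src f = src g" "tgt f = tgt g"
  shows "f \<boxplus> (neg f \<boxplus> g) = g" "neg f \<boxplus> (f \<boxplus> g) = g"
  using add_assoc [of f "neg f" g] add_assoc [of "neg f" f g] assms by (simp_all del: add_assoc)

lemma add_cancel:
  assumes "f \<boxplus> h = g \<boxplus> h" "arr f" "arr g" "arr h" "src f = src h" "tgt f = tgt h"
    "src g = src h" "tgt g = tgt h"
  shows "f = g"
proof -
  have "(f \<boxplus> h) \<boxplus> neg h = (g \<boxplus> h) \<boxplus> neg h" using assms(1) by simp
  then show ?thesis using assms(2-) by simp
qed

lemma add_neg_eq_nul_iff: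
  assumes "arr f" "arr g" "src f = src g" "tgt f = tgt g"
  shows "f \<boxplus> neg g = Nul C (src f) (tgt f) \<longleftrightarrow> f = g"
proof
  assume "f \<boxplus> neg g = Nul C (src f) (tgt f)"
  then have "f \<boxplus> neg g = g \<boxplus> neg g" using assms by simp
  then show "f = g" by (rule add_cancel) (use assms in auto)
qed (use assms in auto)

lemma neg_eqI:
  assumes "f \<boxplus> g = Nul C (src g) (tgt g)" "arr f" "arr g" "src f = src g" "tgt f = tgt g"
  shows "f = neg g"
  using add_cancel [of f g "neg g"] assms by simp

lemma cmp_add [simp]:
  "arr f \<Longrightarrow> arr g \<Longrightarrow> arr g' \<Longrightarrow> src g = tgt f \<Longrightarrow> src g' = tgt f \<Longrightarrow> tgt g = tgt g' \<Longrightarrow>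
    (g \<boxplus> g') \<cdot> f = (g \<cdot> f) \<boxplus> (g' \<cdot> f)"
  "arr f \<Longrightarrow> arr f' \<Longrightarrow> arr g \<Longrightarrow> tgt f = src g \<Longrightarrow> tgt f' = src g \<Longrightarrow> src f = src f' \<Longrightarrow>
    g \<cdot> (f \<boxplus> f') = (g \<cdot> f) \<boxplus> (g \<cdot> f')"
  using cmp_add_left [of "src f" "tgt f" "tgt g" f g g']
    cmp_add_right [of "src f" "src g" "tgt g" f f' g] by auto

lemma cmp_nul [simp]:
  assumes "arr f" "B \<in> Ob C"
  shows "tgt f = A \<Longrightarrow> Nul C A B \<cdot> f = Nul C (src f) B"
    "src f = A \<Longrightarrow> f \<cdot> Nul C B A = Nul C B (tgt f)"
proof -
  show "Nul C A B \<cdot> f = Nul C (src f) B" if "tgt f = A"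
  proof (rule add_cancel [where h = "Nul C A B \<cdot> f"])
    have "Nul C A B \<cdot> f \<boxplus> Nul C A B \<cdot> f = (Nul C A B \<boxplus> Nul C A B) \<cdot> f"
      using assms that by (subst cmp_add) auto
    then show "Nul C A B \<cdot> f \<boxplus> Nul C A B \<cdot> f = Nul C (src f) B \<boxplus> Nul C A B \<cdot> f"
      using assms that by auto
  qed (use assms that in auto)
  show "f \<cdot> Nul C B A = Nul C B (tgt f)" if "src f = A"
  proof (rule add_cancel [where h = "f \<cdot> Nul C B A"])
    have "f \<cdot> Nul C B A \<boxplus> f \<cdot> Nul C B A = f \<cdot> (Nul C B A \<boxplus> Nul C B A)"
      using assms that by (subst cmp_add) auto
    then show "f \<cdot> Nul C B A \<boxplus> f \<cdot> Nul C B A = Nul C B (tgt f) \<boxplus> f \<cdot> Nul C B A"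
      using assms that by auto
  qed (use assms that in auto)
qed

lemma cmp_neg [simp]:
  assumes "arr f" "arr g" "tgt f = src g"
  shows "neg g \<cdot> f = neg (g \<cdot> f)" "g \<cdot> neg f = neg (g \<cdot> f)"
proof -
  show "neg g \<cdot> f = neg (g \<cdot> f)"
    using assms by (intro neg_eqI) (simp_all flip: cmp_add)
  show "g \<cdot> neg f = neg (g \<cdot> f)"
    using assms by (intro neg_eqI) (simp_all flip: cmp_add)
qed

lemma neg_nul [simp]: "A \<in> Ob C \<Longrightarrow> B \<in> Ob C \<Longrightarrow> neg (Nul C A B) = Nul C A B"
  by (rule neg_eqI [symmetric]) auto

lemma neg_neg [simp]: "arr f \<Longrightarrow> neg (neg f) = f"
  by (rule neg_eqI [symmetric]) auto

lemma neg_eq_iff [simp]: "arr f \<Longrightarrow> arr g \<Longrightarrow> neg f = neg g \<longleftrightarrow> f = g"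
  by (metis neg_neg)

text \<open>If the identity of \<open>Z\<close> is zero, composing with it shows that every map into
  or out of \<open>Z\<close> is zero. The equational form is preserved by the shift and by passage
  to the stable category.\<close>

lemma zero_object_iff: "zero_object C Z \<longleftrightarrow> Z \<in> Ob C \<and> Ident C Z = Nul C Z Z"
proof
  assume *: "zero_object C Z"
  then have "\<exists>!f. f \<in> Hom C Z Z" unfolding zero_object_def by blast
  with * show "Z \<in> Ob C \<and> Ident C Z = Nul C Z Z" unfolding zero_object_def
    by (metis arr_ident arr_nul hom_iff)
next
  assume Z: "Z \<in> Ob C \<and> Ident C Z = Nul C Z Z"
  have "f = Nul C Z A" if "A \<in> Ob C" "f \<in> Hom C Z A" for f A
    using that Z cmp_ident(2) [of f Z] cmp_nul(2) [of f Z Z] by auto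
  moreover have "f = Nul C A Z" if "A \<in> Ob C" "f \<in> Hom C A Z" for f A
    using that Z cmp_ident(1) [of f Z] cmp_nul(1) [of f Z Z] by auto
  moreover have "Nul C Z A \<in> Hom C Z A" "Nul C A Z \<in> Hom C A Z" if "A \<in> Ob C" for A
    using Z that by auto
  ultimately show "zero_object C Z"
    unfolding zero_object_def using Z by blast
qed

end

section \<open>Exact generators\<close>

context category
begin

definition injective_on_maps_from where
  "injective_on_maps_from G f \<longleftrightarrow>
    (\<forall>x y. arr x \<and> arr y \<and> src x \<in> G \<and> src x = src y \<and> tgt x = src f \<and> tgt y = src f \<and>
      f \<cdot> x = f \<cdot> y \<longrightarrow> x = y)"

definition surjective_on_maps_from where
  "surjective_on_maps_from G f \<longleftrightarrow>
    (\<forall>y. arr y \<and> src y \<in> G \<and> tgt y = tgt f \<longrightarrow>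
      (\<exists>x. arr x \<and> src x = src y \<and> tgt x = src f \<and> f \<cdot> x = y))"

text \<open>For \<open>F = Hom(G, -)\<close> this is the inclusion of the kernel of
  \<open>F g\<close> in the image of \<open>F f\<close>. The vanishing of \<open>g \<cdot> f\<close>
  is stated separately where it is used.\<close>

definition exact_on_maps_from where
  "exact_on_maps_from G f g \<longleftrightarrow>
    (\<forall>y. arr y \<and> src y \<in> G \<and> tgt y = src g \<and> g \<cdot> y = Nul C (src y) (tgt g) \<longrightarrow>
      (\<exists>x. arr x \<and> src x = src y \<and> tgt x = src f \<and> f \<cdot> x = y))"

lemma mono_iff:
  "monomorphism C A B f \<longleftrightarrow> arr f \<and> src f = A \<and> tgt f = B \<and> injective_on_maps_from (Ob C) f"
proof
  assume "monomorphism C A B f"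
  then show "arr f \<and> src f = A \<and> tgt f = B \<and> injective_on_maps_from (Ob C) f"
    unfolding monomorphism_def injective_on_maps_from_def by (metis hom_iff)
next
  assume "arr f \<and> src f = A \<and> tgt f = B \<and> injective_on_maps_from (Ob C) f"
  then show "monomorphism C A B f"
    unfolding monomorphism_def injective_on_maps_from_def by auto
qed

lemma mono_cancel:
  assumes "monomorphism C A B f" "f \<cdot> x = f \<cdot> y" "arr x" "arr y" "src x = src y"
    "tgt x = A" "tgt y = A"
  shows "x = y"
  using assms unfolding mono_iff injective_on_maps_from_def by (metis arr_ob(1))

lemma epi_cancel:
  assumes "epimorphism C A B f" "x \<cdot> f = y \<cdot> f" "arr x" "arr y" "tgt x = tgt y"
    "src x = B" "src y = B"
  shows "x = y"
  using assms unfolding epimorphism_def by (metis hom_iff arr_ob)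

lemma epiI:
  assumes "arr f" "src f = A" "tgt f = B"
    and "\<And>x y. arr x \<Longrightarrow> arr y \<Longrightarrow> src x = B \<Longrightarrow> src y = B \<Longrightarrow> tgt x = tgt y \<Longrightarrow>
      x \<cdot> f = y \<cdot> f \<Longrightarrow> x = y"
  shows "epimorphism C A B f"
  unfolding epimorphism_def using assms by auto

lemma kernel_simps:
  assumes "is_kernel C A B f K k"
  shows "A \<in> Ob C" "B \<in> Ob C" "K \<in> Ob C" "arr f" "src f = A" "tgt f = B"
    "arr k" "src k = K" "tgt k = A" "f \<cdot> k = Nul C K B"
  using assms unfolding is_kernel_def by auto

lemma kernel_factor:
  assumes "is_kernel C A B f K k" "f \<cdot> g = Nul C (src g) B" "arr g" "tgt g = A"
  obtains h where "arr h" "src h = src g" "tgt h = K" "k \<cdot> h = g"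
  using assms unfolding is_kernel_def by (metis hom_iff arr_ob)

lemma cokernel_simps:
  assumes "is_cokernel C A B f Q c"
  shows "A \<in> Ob C" "B \<in> Ob C" "Q \<in> Ob C" "arr f" "src f = A" "tgt f = B"
    "arr c" "src c = B" "tgt c = Q" "c \<cdot> f = Nul C A Q"
  using assms unfolding is_cokernel_def by auto

lemma cokernel_factor:
  assumes "is_cokernel C A B f Q c" "g \<cdot> f = Nul C A (tgt g)" "arr g" "src g = B"
  obtains h where "arr h" "src h = Q" "tgt h = tgt g" "h \<cdot> c = g"
  using assms unfolding is_cokernel_def by (metis hom_iff arr_ob)

end

section \<open>Kernels are monic, cokernels are epic, push-outs are cokernels\<close>

context preadditive_category
begin

lemma kernel_mono:
  assumes K: "is_kernel C A B f K k"
  shows "monomorphism C K A k"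
  unfolding mono_iff injective_on_maps_from_def
proof (intro conjI allI impI)
  note [simp] = kernel_simps [OF K]
  show "arr k" "src k = K" "tgt k = A" by auto
  fix x y
  assume *: "arr x \<and> arr y \<and> src x \<in> Ob C \<and> src x = src y \<and> tgt x = src k \<and> tgt y = src k \<and>
      k \<cdot> x = k \<cdot> y"
  then have "f \<cdot> (k \<cdot> x) = Nul C (src x) B"
    by (subst assoc_eq [where t = "Nul C K B"]) auto
  with * show "x = y"
    using K unfolding is_kernel_def by (metis arr_cmp hom_iff kernel_simps(7-9) [OF K])
qed

lemma cokernel_epi:
  assumes K: "is_cokernel C A B f Q c"
  shows "epimorphism C B Q c"
proof (rule epiI)
  note [simp] = cokernel_simps [OF K]
  show "arr c" "src c = B" "tgt c = Q" by auto
  fix x y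
  assume *: "arr x" "arr y" "src x = Q" "src y = Q" "tgt x = tgt y" "x \<cdot> c = y \<cdot> c"
  then have "(x \<cdot> c) \<cdot> f = Nul C A (tgt x)" by simp
  with * show "x = y"
    using K unfolding is_cokernel_def by (metis arr_ob arr_cmp hom_iff cokernel_simps(7-9) [OF K])
qed

text \<open>A map \<open>t\<close> on the direct sum is the pair of \<open>t \<cdot> i\<close> and
  \<open>t \<cdot> j\<close>. It kills the difference of the two maps from \<open>D\<close> exactly
  when this pair is a cocone over the span. Thus the exactness of cokernels becomes available for
  push-outs.\<close>

lemma pushout_cokernel:
  assumes P: "is_pushout C D A B f g P p q" and S: "biproduct C A B S i j a b"
  shows "is_cokernel C D S (i \<cdot> f \<boxplus> neg (j \<cdot> g)) P (p \<cdot> a \<boxplus> q \<cdot> b)"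
proof -
  have obs [simp]: "A \<in> Ob C" "B \<in> Ob C" "D \<in> Ob C" "P \<in> Ob C" "S \<in> Ob C"
    using P S unfolding is_pushout_def biproduct_def by auto
  have [simp]: "arr f" "src f = D" "tgt f = A" "arr g" "src g = D" "tgt g = B"
    "arr p" "src p = A" "tgt p = P" "arr q" "src q = B" "tgt q = P" "q \<cdot> g = p \<cdot> f"
    using P unfolding is_pushout_def by auto
  have [simp]: "arr i" "src i = A" "tgt i = S" "arr j" "src j = B" "tgt j = S"
    "arr a" "src a = S" "tgt a = A" "arr b" "src b = S" "tgt b = B"
    and bip [simp]: "a \<cdot> i = Ident C A" "b \<cdot> j = Ident C B" "b \<cdot> i = Nul C A B" "a \<cdot> j = Nul C B A"
    and bip_sum: "(i \<cdot> a) \<boxplus> (j \<cdot> b) = Ident C S"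
    using S unfolding biproduct_def by auto
  note [simp] = bip [THEN assoc_eq]
  show ?thesis
    unfolding is_cokernel_def
  proof (intro conjI ballI impI)
    fix W t
    assume W: "W \<in> Ob C" and "t \<in> Hom C S W"
      and t0: "t \<cdot> (i \<cdot> f \<boxplus> neg (j \<cdot> g)) = Nul C D W"
    then have t [simp]: "arr t" "src t = S" "tgt t = W" by auto
    have "t \<cdot> (i \<cdot> f) \<boxplus> neg (t \<cdot> (j \<cdot> g)) = Nul C D W"
      using t0 W by simp
    then have "t \<cdot> i \<cdot> f = t \<cdot> j \<cdot> g"
      using add_neg_eq_nul_iff [of "t \<cdot> (i \<cdot> f)" "t \<cdot> (j \<cdot> g)"] W by simp
    then have ex: "\<exists>!h. h \<in> Hom C P W \<and> h \<cdot> p = t \<cdot> i \<and> h \<cdot> q = t \<cdot> j"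
      using P W unfolding is_pushout_def by auto
    have "h \<cdot> (p \<cdot> a \<boxplus> q \<cdot> b) = t \<longleftrightarrow> h \<cdot> p = t \<cdot> i \<and> h \<cdot> q = t \<cdot> j" if "h \<in> Hom C P W" for h
    proof
      have h [simp]: "arr h" "src h = P" "tgt h = W" using that W by auto
      {
        assume "h \<cdot> (p \<cdot> a \<boxplus> q \<cdot> b) = t"
        then have "t \<cdot> i = h \<cdot> (p \<cdot> a \<boxplus> q \<cdot> b) \<cdot> i" "t \<cdot> j = h \<cdot> (p \<cdot> a \<boxplus> q \<cdot> b) \<cdot> j" by simp_all
        then show "h \<cdot> p = t \<cdot> i \<and> h \<cdot> q = t \<cdot> j" by simp
      next
        assume "h \<cdot> p = t \<cdot> i \<and> h \<cdot> q = t \<cdot> j"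
        then have "h \<cdot> (p \<cdot> a \<boxplus> q \<cdot> b) = t \<cdot> i \<cdot> a \<boxplus> t \<cdot> j \<cdot> b"
          by (simp add: assoc_eq del: assoc)
        also have "\<dots> = t \<cdot> (i \<cdot> a \<boxplus> j \<cdot> b)" by simp
        finally show "h \<cdot> (p \<cdot> a \<boxplus> q \<cdot> b) = t" by (simp add: bip_sum)
      }
    qed
    with ex show "\<exists>!h. h \<in> Hom C P W \<and> h \<cdot> (p \<cdot> a \<boxplus> q \<cdot> b) = t" by metis
  qed simp_all
qed

end

text \<open>Maps out of \<open>G\<close> behave like the elements of an object: they separate morphisms, and
  cokernels are exact on them.\<close>

locale exact_generators = additive_category +
  fixes G
  assumes generators_ob: "G \<subseteq> Ob C"
    and generate: "\<lbrakk>arr f; arr g; src f = src g; tgt f = tgt g;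
      \<And>x. arr x \<Longrightarrow> src x \<in> G \<Longrightarrow> tgt x = src f \<Longrightarrow> f \<cdot> x = g \<cdot> x\<rbrakk> \<Longrightarrow> f = g"
    and ex_exact_cokernel: "arr f \<Longrightarrow> \<exists>c. is_cokernel C (src f) (tgt f) f (tgt c) c \<and>
      exact_on_maps_from G f c \<and> surjective_on_maps_from G c"
begin

section \<open>Monomorphisms and epimorphisms detected on generators\<close>

lemma injective_mono:
  assumes f: "arr f" "src f = A" "tgt f = B" and inj: "injective_on_maps_from G f"
  shows "monomorphism C A B f"
  unfolding mono_iff injective_on_maps_from_def
proof (intro conjI allI impI)
  fix x y
  assume "arr x \<and> arr y \<and> src x \<in> Ob C \<and> src x = src y \<and> tgt x = src f \<and> tgt y = src f \<and>
    f \<cdot> x = f \<cdot> y"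
  then have xy: "arr x" "arr y" "src x = src y" "tgt x = src f" "tgt y = src f"
    and eq: "f \<cdot> x = f \<cdot> y"
    by blast+
  show "x = y"
  proof (rule generate)
    fix z assume z: "arr z" "src z \<in> G" "tgt z = src x"
    have "f \<cdot> (x \<cdot> z) = f \<cdot> (y \<cdot> z)"
      using xy z f(1) by (subst assoc_eq [OF eq]) simp_all
    then show "x \<cdot> z = y \<cdot> z"
      using inj [unfolded injective_on_maps_from_def, rule_format, of "x \<cdot> z" "y \<cdot> z"] xy z
      by simp
  qed (use xy in simp_all)
qed (use f in simp_all)

lemma injectiveI:
  assumes "arr f"
    and "\<And>x. arr x \<Longrightarrow> src x \<in> G \<Longrightarrow> tgt x = src f \<Longrightarrow> f \<cdot> x = Nul C (src x) (tgt f) \<Longrightarrow>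
      x = Nul C (src x) (src f)"
  shows "injective_on_maps_from G f"
  unfolding injective_on_maps_from_def
proof (intro allI impI)
  fix x y
  assume *: "arr x \<and> arr y \<and> src x \<in> G \<and> src x = src y \<and> tgt x = src f \<and> tgt y = src f \<and>
    f \<cdot> x = f \<cdot> y"
  then have "x \<boxplus> neg y = Nul C (src y) (src f)"
    using assms(1) assms(2) [of "x \<boxplus> neg y"] by auto
  with * show "x = y" using add_neg_eq_nul_iff [of x y] by simp
qed

text \<open>Every test map \<open>z\<close> into the target lifts along \<open>f\<close>, so two
  maps that agree after \<open>f\<close> agree on all test maps.\<close>

lemma surjective_epi:
  assumes "arr f" "src f = A" "tgt f = B" "surjective_on_maps_from G f"
  shows "epimorphism C A B f"
proof (rule epiI)
  fix x y
  assume *: "arr x" "arr y" "src x = B" "src y = B" "tgt x = tgt y" "x \<cdot> f = y \<cdot> f"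
  show "x = y"
  proof (rule generate)
    fix z assume z: "arr z" "src z \<in> G" "tgt z = src x"
    then obtain w where w: "arr w" "src w = src z" "tgt w = src f" "f \<cdot> w = z"
      using assms(3,4) *(3) unfolding surjective_on_maps_from_def by auto
    have "x \<cdot> (f \<cdot> w) = y \<cdot> (f \<cdot> w)"
      using * w(1-3) assms(1-3) by (subst assoc_eq [OF *(6)]) auto
    then show "x \<cdot> z = y \<cdot> z" using w(4) by simp
  qed (use * in auto)
qed (use assms in auto)

text \<open>The locale provides exactness for one cokernel of each map only. Any two cokernels are
  related by comparison maps \<open>h\<close> and \<open>k\<close>, which carry exactness and
  surjectivity over to an arbitrary one.\<close>

lemma cokernel_exact:
  assumes c: "is_cokernel C A B f Q c"
  shows "exact_on_maps_from G f c" "surjective_on_maps_from G c"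
proof -
  note [simp] = cokernel_simps [OF c]
  obtain c' where "is_cokernel C (src f) (tgt f) f (tgt c') c'"
    and ex: "exact_on_maps_from G f c'" and su: "surjective_on_maps_from G c'"
    using ex_exact_cokernel [of f] by auto
  then have c': "is_cokernel C A B f (tgt c') c'" by simp
  note [simp] = cokernel_simps(3,7,8,10) [OF c']
  obtain h where h [simp]: "arr h" "src h = Q" "tgt h = tgt c'" and hc: "h \<cdot> c = c'"
    by (rule cokernel_factor [OF c, of c']) auto
  obtain k where k [simp]: "arr k" "src k = tgt c'" "tgt k = Q" and kc: "k \<cdot> c' = c"
    by (rule cokernel_factor [OF c', of c]) auto
  have hk: "k \<cdot> h = Ident C Q"
    by (rule epi_cancel [OF cokernel_epi [OF c]]) (simp_all add: hc kc)
  show "exact_on_maps_from G f c"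
    unfolding exact_on_maps_from_def
  proof (intro allI impI)
    fix y assume y: "arr y \<and> src y \<in> G \<and> tgt y = src c \<and> c \<cdot> y = Nul C (src y) (tgt c)"
    then have "h \<cdot> (c \<cdot> y) = Nul C (src y) (tgt c')" by simp
    then have "c' \<cdot> y = Nul C (src y) (tgt c')" using y by (subst (asm) assoc_eq [OF hc]) auto
    then show "\<exists>x. arr x \<and> src x = src y \<and> tgt x = src f \<and> f \<cdot> x = y"
      using ex y unfolding exact_on_maps_from_def by auto
  qed
  show "surjective_on_maps_from G c"
    unfolding surjective_on_maps_from_def
  proof (intro allI impI)
    fix y assume y: "arr y \<and> src y \<in> G \<and> tgt y = tgt c"
    then obtain x where x: "arr x" "src x = src y" "tgt x = B" "c' \<cdot> x = h \<cdot> y"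
      using su unfolding surjective_on_maps_from_def by (metis arr_cmp h cokernel_simps(8,9) [OF c'] cokernel_simps(9) [OF c])
    have "c \<cdot> x = k \<cdot> (c' \<cdot> x)" using x(1-3) by (simp add: assoc_eq [OF kc])
    also have "\<dots> = y" unfolding x(4) using y by (simp add: assoc_eq [OF hk])
    finally show "\<exists>x. arr x \<and> src x = src y \<and> tgt x = src c \<and> c \<cdot> x = y"
      using x by auto
  qed
qed

text \<open>An epimorphism has zero cokernel \<open>c\<close>. Every test map is then killed by
  \<open>c\<close>, and exactness lifts it along \<open>f\<close>.\<close>

lemma epi_surjective:
  assumes f: "epimorphism C A B f"
  shows "surjective_on_maps_from G f"
proof -
  have [simp]: "arr f" "src f = A" "tgt f = B" "A \<in> Ob C" "B \<in> Ob C"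
    using f unfolding epimorphism_def by auto
  obtain c where "is_cokernel C (src f) (tgt f) f (tgt c) c" and ex: "exact_on_maps_from G f c"
    using ex_exact_cokernel [of f] by auto
  then have c: "is_cokernel C A B f (tgt c) c" by simp
  note [simp] = cokernel_simps(3,7,8,10) [OF c]
  have "c = Nul C B (tgt c)"
    by (rule epi_cancel [OF f]) simp_all
  then have "c \<cdot> y = Nul C (src y) (tgt c)" if "arr y" "tgt y = B" for y
    using that cmp_nul(1) [of y "tgt c" B] by simp
  then show ?thesis
    using ex unfolding exact_on_maps_from_def surjective_on_maps_from_def by simp
qed

text \<open>On maps out of \<open>G\<close> both the coimage and the image of \<open>f\<close> become the set-theoretic image
  of composition with \<open>f\<close>.\<close>

lemma canonical_map_regular:
  assumes k: "is_kernel C A B f K k" and p: "is_cokernel C K A k I p"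
    and c: "is_cokernel C A B f Q c" and j: "is_kernel C B Q c J j"
  shows "\<exists>h\<in>Hom C I J. j \<cdot> (h \<cdot> p) = f \<and> regular_morphism C I J h"
proof -
  note [simp] = kernel_simps [OF k] cokernel_simps [OF c] kernel_simps [OF j] cokernel_simps [OF p]
  obtain f' where f' [simp]: "arr f'" "src f' = I" "tgt f' = B" and f'p: "f' \<cdot> p = f"
    by (rule cokernel_factor [OF p, of f]) auto
  have "c \<cdot> f' = Nul C I Q"
    by (rule epi_cancel [OF cokernel_epi [OF p]]) (simp_all add: f'p)
  then obtain h where h [simp]: "arr h" "src h = I" "tgt h = J" and jh: "j \<cdot> h = f'"
    by (rule_tac kernel_factor [OF j, of f']) auto
  have jhp: "j \<cdot> (h \<cdot> p) = f" by (simp add: assoc_eq [OF jh] f'p)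
  have "injective_on_maps_from G h"
  proof (rule injectiveI)
    \<comment> \<open>Lift \<open>x\<close> along \<open>p\<close> to \<open>a\<close>. Since
      \<open>f \<cdot> a\<close> is zero, \<open>a\<close> comes from the kernel \<open>k\<close>,
      which \<open>p\<close> annihilates.\<close>
    fix x assume x: "arr x" "src x \<in> G" "tgt x = src h" "h \<cdot> x = Nul C (src x) (tgt h)"
    obtain a where a: "arr a" "src a = src x" "tgt a = A" "p \<cdot> a = x"
      using cokernel_exact(2) [OF p] x unfolding surjective_on_maps_from_def by auto
    have "f \<cdot> a = j \<cdot> (h \<cdot> (p \<cdot> a))" using a(1-3) by (simp flip: jhp)
    then have "f \<cdot> a = Nul C (src a) B" unfolding a(4) x(4) using a x(1) by simp
    then obtain z where z: "arr z" "src z = src a" "tgt z = K" "k \<cdot> z = a"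
      by (rule kernel_factor [OF k]) (use a in auto)
    have "x = p \<cdot> k \<cdot> z" using a z by (simp del: cokernel_simps(10) [OF p])
    with z a x show "x = Nul C (src x) (src h)" by simp
  qed simp
  moreover have "surjective_on_maps_from G h"
    unfolding surjective_on_maps_from_def
  proof (intro allI impI)
    \<comment> \<open>As \<open>c\<close> kills \<open>j \<cdot> y\<close>, exactness gives
      \<open>a\<close> with \<open>f \<cdot> a = j \<cdot> y\<close>. Cancelling the monomorphism
      \<open>j\<close> shows that \<open>p \<cdot> a\<close> is a preimage of
      \<open>y\<close>.\<close>
    fix y assume y: "arr y \<and> src y \<in> G \<and> tgt y = tgt h"
    then have "c \<cdot> (j \<cdot> y) = Nul C (src y) Q"
      by (subst assoc_eq [OF kernel_simps(10) [OF j]]) auto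
    then obtain a where a: "arr a" "src a = src y" "tgt a = A" "f \<cdot> a = j \<cdot> y"
      using cokernel_exact(1) [OF c] y unfolding exact_on_maps_from_def
      by (metis arr_cmp h(3) cokernel_simps(5,8,9) [OF c] kernel_simps(7-9) [OF j])
    have "j \<cdot> (h \<cdot> (p \<cdot> a)) = j \<cdot> y" using a by (simp flip: jhp)
    then have "h \<cdot> (p \<cdot> a) = y"
      by (rule mono_cancel [OF kernel_mono [OF j]]) (use a y in auto)
    then show "\<exists>x. arr x \<and> src x = src y \<and> tgt x = src h \<and> h \<cdot> x = y"
      using a by (intro exI [of _ "p \<cdot> a"]) auto
  qed
  ultimately have "regular_morphism C I J h"
    unfolding regular_morphism_def by (simp add: injective_mono surjective_epi)
  with jhp show ?thesis by auto
qed

text \<open>On test maps \<open>f\<close> is surjective: \<open>g \<cdot> y\<close> lifts along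
  \<open>f\<close> to some \<open>a\<close>, and the pair of \<open>a\<close> and \<open>y\<close>
  defines a map into the pull-back that lifts \<open>y\<close> along \<open>q\<close>.\<close>

lemma epi_pullback:
  assumes P: "is_pullback C A B D f g P p q" and f: "epimorphism C A D f"
  shows "epimorphism C P B q"
proof (rule surjective_epi)
  have [simp]: "A \<in> Ob C" "B \<in> Ob C" "D \<in> Ob C" "P \<in> Ob C"
    using P unfolding is_pullback_def by auto
  have [simp]: "arr f" "src f = A" "tgt f = D" "arr g" "src g = B" "tgt g = D"
    "arr p" "src p = P" "tgt p = A" and q: "arr q" "src q = P" "tgt q = B"
    using P unfolding is_pullback_def by auto
  show "arr q" "src q = P" "tgt q = B" by fact+
  show "surjective_on_maps_from G q"
    unfolding surjective_on_maps_from_def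
  proof (intro allI impI)
    fix y assume y: "arr y \<and> src y \<in> G \<and> tgt y = tgt q"
    then obtain a where a: "arr a" "src a = src y" "tgt a = A" "f \<cdot> a = g \<cdot> y"
      using epi_surjective [OF f] q unfolding surjective_on_maps_from_def by (auto dest!: spec [of _ "g \<cdot> y"])
    then have "a \<in> Hom C (src y) A" "y \<in> Hom C (src y) B" "src y \<in> Ob C"
      using y q by auto
    with a(4) obtain h where "h \<in> Hom C (src y) P" "q \<cdot> h = y"
      using P unfolding is_pullback_def by blast
    then show "\<exists>x. arr x \<and> src x = src y \<and> tgt x = src q \<and> q \<cdot> x = y"
      using y q by auto
  qed
qed

text \<open>If \<open>q \<cdot> x\<close> is zero, the element \<open>(0, x)\<close> of the direct
  sum dies in the push-out. By exactness it has the form \<open>(f d, - g d)\<close>. Since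
  \<open>f\<close> is monic, \<open>d\<close> vanishes, and so does \<open>x\<close>.\<close>

lemma mono_pushout:
  assumes P: "is_pushout C D A B f g P p q" and f: "monomorphism C D A f"
  shows "monomorphism C B P q"
proof (rule injective_mono)
  have [simp]: "A \<in> Ob C" "B \<in> Ob C" "D \<in> Ob C" "P \<in> Ob C"
    using P unfolding is_pushout_def by auto
  have [simp]: "arr f" "src f = D" "tgt f = A" "arr g" "src g = D" "tgt g = B"
    "arr p" "src p = A" "tgt p = P" and q [simp]: "arr q" "src q = B" "tgt q = P"
    using P unfolding is_pushout_def by auto
  show "arr q" "src q = B" "tgt q = P" by fact+
  obtain S i j a b where S: "biproduct C A B S i j a b"
    using ex_direct_sum unfolding is_direct_sum_def by (metis \<open>A \<in> Ob C\<close> \<open>B \<in> Ob C\<close>)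
  have [simp]: "S \<in> Ob C" using S unfolding biproduct_def by auto
  have [simp]: "arr i" "src i = A" "tgt i = S" "arr j" "src j = B" "tgt j = S"
    "arr a" "src a = S" "tgt a = A" "arr b" "src b = S" "tgt b = B"
    and bip [simp]: "a \<cdot> i = Ident C A" "b \<cdot> j = Ident C B" "b \<cdot> i = Nul C A B" "a \<cdot> j = Nul C B A"
    using S unfolding biproduct_def by auto
  note [simp] = bip [THEN assoc_eq]
  note ex = cokernel_exact(1) [OF pushout_cokernel [OF P S]]
  show "injective_on_maps_from G q"
  proof (rule injectiveI)
    fix x assume x: "arr x" "src x \<in> G" "tgt x = src q" "q \<cdot> x = Nul C (src x) (tgt q)"
    have "(p \<cdot> a \<boxplus> q \<cdot> b) \<cdot> (j \<cdot> x) = Nul C (src x) P"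
      using x by simp
    then obtain d where d: "arr d" "src d = src x" "tgt d = D"
      and "(i \<cdot> f \<boxplus> neg (j \<cdot> g)) \<cdot> d = j \<cdot> x"
      using ex x unfolding exact_on_maps_from_def by (auto dest!: spec [of _ "j \<cdot> x"])
    then have eq: "i \<cdot> (f \<cdot> d) \<boxplus> neg (j \<cdot> (g \<cdot> d)) = j \<cdot> x" using d by simp
    have "a \<cdot> (i \<cdot> (f \<cdot> d) \<boxplus> neg (j \<cdot> (g \<cdot> d))) = a \<cdot> (j \<cdot> x)" unfolding eq ..
    then have "f \<cdot> d = f \<cdot> Nul C (src x) D" using d x by simp
    then have d0: "d = Nul C (src x) D"
      by (rule mono_cancel [OF f]) (use d x in auto)
    have "b \<cdot> (i \<cdot> (f \<cdot> d) \<boxplus> neg (j \<cdot> (g \<cdot> d))) = b \<cdot> (j \<cdot> x)" unfolding eq ..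
    then show "x = Nul C (src x) (src q)" unfolding d0 using d x by simp
  qed simp
qed

text \<open>Existence of kernels is a separate input: the generators supply cokernels, and kernels
  are constructed later from weak kernels.\<close>

theorem semiabelian_integral:
  assumes "\<And>f. arr f \<Longrightarrow> \<exists>k. is_kernel C (src f) (tgt f) f (src k) k"
  shows "semiabelian_category C \<and> integral_category C"
proof -
  interpret preabelian_category C
  proof
    show "\<exists>K k. is_kernel C A B f K k" if "A \<in> Ob C" "B \<in> Ob C" "f \<in> Hom C A B" for A B f
      using that assms [of f] by auto
    show "\<exists>Q c. is_cokernel C A B f Q c" if "A \<in> Ob C" "B \<in> Ob C" "f \<in> Hom C A B" for A B f
      using that ex_exact_cokernel [of f] by auto
  qed
  have "semiabelian_category C"
    by unfold_locales (rule canonical_map_regular)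
  moreover have "integral_category C"
    by unfold_locales (rule epi_pullback mono_pushout; assumption)+
  ultimately show ?thesis ..
qed

end

section \<open>Stable categories\<close>

text \<open>The maps through \<open>Y\<close> are exactly those killed by all maps from
  \<open>G\<close>. The quotient by them is therefore controlled by composition with test
  maps.\<close>

locale tested_ideal = additive_category +
  fixes G Y
  assumes test_ob: "G \<subseteq> Ob C"
    and ideal_ob: "Y \<subseteq> Ob C"
    and factoring_iff: "arr f \<Longrightarrow> f \<in> factoring_maps C Y (src f) (tgt f) \<longleftrightarrow>
      (\<forall>x. arr x \<and> src x \<in> G \<and> tgt x = src f \<longrightarrow> f \<cdot> x = Nul C (src x) (tgt f))"
begin

definition stably_equal where
  "stably_equal f g \<longleftrightarrow> arr f \<and> arr g \<and> src f = src g \<and> tgt f = tgt g \<and>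
    (\<forall>x. arr x \<and> src x \<in> G \<and> tgt x = src g \<longrightarrow> f \<cdot> x = g \<cdot> x)"

abbreviation "S \<equiv> stable_category C Y"

definition stable_class where
  "stable_class f = stable_rel C Y `` {f}"

text \<open>The difference of \<open>f\<close> and \<open>g\<close> lies in the ideal if and only if
  test maps kill it. This replaces the search for factorizations by equations after precomposition,
  from which the congruence properties are immediate.\<close>

lemma stable_rel_iff: "(f, g) \<in> stable_rel C Y \<longleftrightarrow> stably_equal f g"
proof
  assume "(f, g) \<in> stable_rel C Y"
  then obtain h where fg: "arr f" "arr g" "src f = src g" "tgt f = tgt g" "f = g \<boxplus> h"
    and h: "h \<in> factoring_maps C Y (src g) (tgt g)"
    unfolding stable_rel_def by auto
  have h_arr: "arr h" "src h = src g" "tgt h = tgt g"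
    using h fg(2) ideal_ob unfolding factoring_maps_def by auto
  have "f \<cdot> x = g \<cdot> x" if x: "arr x" "src x \<in> G" "tgt x = src g" for x
  proof -
    have "h \<cdot> x = Nul C (src x) (tgt g)"
      using factoring_iff [of h] h h_arr x by simp
    then show ?thesis using fg(2,5) h_arr x by simp
  qed
  with fg(1-4) show "stably_equal f g" unfolding stably_equal_def by blast
next
  assume "stably_equal f g"
  then have fg: "arr f" "arr g" "src f = src g" "tgt f = tgt g"
    and eq: "\<And>x. arr x \<Longrightarrow> src x \<in> G \<Longrightarrow> tgt x = src g \<Longrightarrow> f \<cdot> x = g \<cdot> x"
    unfolding stably_equal_def by blast+
  have "(neg g \<boxplus> f) \<cdot> x = Nul C (src x) (tgt g)" if "arr x" "src x \<in> G" "tgt x = src g" for x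
    using fg eq [OF that] that by simp
  then have "neg g \<boxplus> f \<in> factoring_maps C Y (src g) (tgt g)"
    using factoring_iff [of "neg g \<boxplus> f"] fg by simp
  moreover have "f = g \<boxplus> (neg g \<boxplus> f)" using fg by simp
  ultimately show "(f, g) \<in> stable_rel C Y"
    unfolding stable_rel_def mem_Collect_eq prod.case using fg
    by (metis arr_ob hom_iff)
qed

lemma stably_equal_refl [simp]: "arr f \<Longrightarrow> stably_equal f f"
  unfolding stably_equal_def by simp

lemma stably_equal_sym: "stably_equal f g \<Longrightarrow> stably_equal g f"
  unfolding stably_equal_def by metis

lemma stably_equal_trans: "stably_equal f g \<Longrightarrow> stably_equal g h \<Longrightarrow> stably_equal f h"
  unfolding stably_equal_def by metis

lemma stably_equal_cmp:
  assumes f: "stably_equal f f'" and g: "stably_equal g g'" and "tgt f = src g"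
  shows "stably_equal (g \<cdot> f) (g' \<cdot> f')"
proof -
  have *: "arr f" "arr f'" "arr g" "arr g'" "src f = src f'" "tgt f = tgt f'" "src g = src g'"
    "tgt g = tgt g'" "tgt f' = src g'"
    using assms unfolding stably_equal_def by metis+
  have "g \<cdot> (f \<cdot> x) = g' \<cdot> (f' \<cdot> x)" if x: "arr x" "src x \<in> G" "tgt x = src f'" for x
  proof -
    have "f \<cdot> x = f' \<cdot> x" using f x unfolding stably_equal_def by blast
    moreover have "g \<cdot> (f' \<cdot> x) = g' \<cdot> (f' \<cdot> x)"
      using g x * unfolding stably_equal_def by (metis arr_cmp)
    ultimately show ?thesis by simp
  qed
  then show ?thesis unfolding stably_equal_def using * by simp
qed

lemma stably_equal_add:
  assumes f: "stably_equal f f'" and g: "stably_equal g g'" and "src f = src g" "tgt f = tgt g"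
  shows "stably_equal (f \<boxplus> g) (f' \<boxplus> g')"
proof -
  have *: "arr f" "arr f'" "arr g" "arr g'" "src f = src g'" "tgt f = tgt g'" "src f' = src g'"
    "tgt f' = tgt g'" "src g = src g'" "tgt g = tgt g'"
    using assms unfolding stably_equal_def by metis+
  have "f \<cdot> x \<boxplus> g \<cdot> x = f' \<cdot> x \<boxplus> g' \<cdot> x"
    if x: "arr x" "src x \<in> G" "tgt x = src g'" for x
  proof -
    have "f \<cdot> x = f' \<cdot> x" "g \<cdot> x = g' \<cdot> x" using f g x * unfolding stably_equal_def by metis+
    then show ?thesis by simp
  qed
  then show ?thesis unfolding stably_equal_def using * by simp
qed

text \<open>The identity of a test object is itself a test map. Hence maps out of \<open>G\<close>
  are not identified in the quotient, and statements about them transfer unchanged.\<close>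

lemma stably_equal_test:
  assumes "stably_equal x y" "src x \<in> G"
  shows "x = y"
proof -
  have "x \<cdot> Ident C (src y) = y \<cdot> Ident C (src y)"
    using assms test_ob unfolding stably_equal_def by (metis arr_ident arr_ob(1))
  with assms show ?thesis unfolding stably_equal_def by auto
qed

lemma stable_class_eq [simp]:
  "arr f \<Longrightarrow> arr g \<Longrightarrow> stable_class f = stable_class g \<longleftrightarrow> stably_equal f g"
  unfolding stable_class_def Image_singleton stable_rel_iff
  using stably_equal_refl stably_equal_sym stably_equal_trans by blast

lemma stable_Ob [simp]: "Ob S = Ob C"
  by (simp add: stable_category_def)

lemma stable_Hom [simp]: "Hom S A B = stable_class ` Hom C A B"
  by (auto simp add: stable_category_def quotient_def stable_class_def)

lemma stable_Ident: "Ident S A = stable_class (Ident C A)"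
  by (simp add: stable_category_def stable_class_def)

lemma stable_Nul: "Nul S A B = stable_class (Nul C A B)"
  by (simp add: stable_category_def stable_class_def)

text \<open>The operations of the stable category saturate the set of results on all
  representatives. This lemma recognizes that saturation as one class.\<close>

lemma stable_class_Image:
  assumes "f \<in> M" "\<And>g. g \<in> M \<Longrightarrow> stably_equal g f"
  shows "stable_rel C Y `` M = stable_class f"
proof -
  have eq: "stable_class g = stable_class f" if "g \<in> M" for g
  proof -
    have "arr g" "arr f" using assms(2) [OF that] unfolding stably_equal_def by simp_all
    then show ?thesis by (simp add: assms(2) [OF that])
  qed
  have "stable_rel C Y `` M = (\<Union>g\<in>M. stable_class g)"
    unfolding stable_class_def by blast
  also have "\<dots> = (\<Union>g\<in>M. stable_class f)" using eq by simp
  also have "\<dots> = stable_class f" using assms(1) by blast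
  finally show ?thesis .
qed

lemma stable_Cmp:
  assumes "arr f" "arr g" "tgt f = src g"
  shows "Cmp S (stable_class g) (stable_class f) = stable_class (g \<cdot> f)"
proof -
  have "stable_rel C Y `` {g' \<cdot> f' | g' f'. g' \<in> stable_class g \<and> f' \<in> stable_class f} =
      stable_class (g \<cdot> f)"
  proof (rule stable_class_Image)
    show "g \<cdot> f \<in> {g' \<cdot> f' | g' f'. g' \<in> stable_class g \<and> f' \<in> stable_class f}"
      using assms(1,2) stably_equal_refl unfolding stable_class_def Image_singleton stable_rel_iff by blast
    fix h assume "h \<in> {g' \<cdot> f' | g' f'. g' \<in> stable_class g \<and> f' \<in> stable_class f}"
    then obtain g' f' where "h = g' \<cdot> f'" "stably_equal g g'" "stably_equal f f'"
      unfolding stable_class_def by (auto simp: stable_rel_iff)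
    then show "stably_equal h (g \<cdot> f)"
      using stably_equal_cmp [of f f' g g'] assms(3) stably_equal_sym by blast
  qed
  then show ?thesis by (simp add: stable_category_def)
qed

lemma stable_Add:
  assumes "arr f" "arr g" "src f = src g" "tgt f = tgt g"
  shows "Add S (stable_class f) (stable_class g) = stable_class (f \<boxplus> g)"
proof -
  have "stable_rel C Y `` {f' \<boxplus> g' | f' g'. f' \<in> stable_class f \<and> g' \<in> stable_class g} =
      stable_class (f \<boxplus> g)"
  proof (rule stable_class_Image)
    show "f \<boxplus> g \<in> {f' \<boxplus> g' | f' g'. f' \<in> stable_class f \<and> g' \<in> stable_class g}"
      using assms(1,2) stably_equal_refl unfolding stable_class_def Image_singleton stable_rel_iff by blast
    fix h assume "h \<in> {f' \<boxplus> g' | f' g'. f' \<in> stable_class f \<and> g' \<in> stable_class g}"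
    then obtain f' g' where "h = f' \<boxplus> g'" "stably_equal g g'" "stably_equal f f'"
      unfolding stable_class_def by (auto simp: stable_rel_iff)
    then show "stably_equal h (f \<boxplus> g)"
      using stably_equal_add [of f f' g g'] assms(3,4) stably_equal_sym by blast
  qed
  then show ?thesis by (simp add: stable_category_def)
qed

lemmas stable_simps = stable_Ident stable_Nul stable_Cmp stable_Add

lemma stable_category: "category S"
proof
  fix A B A' B' F
  assume ob: "A \<in> Ob S" "B \<in> Ob S" "A' \<in> Ob S" "B' \<in> Ob S"
    and F: "F \<in> Hom S A B" "F \<in> Hom S A' B'"
  obtain f f' where "arr f" "src f = A" "tgt f = B" "arr f'" "src f' = A'" "tgt f' = B'"
    "stable_class f = F" "stable_class f' = F"
    using F ob by auto
  then have "stably_equal f f'" using stable_class_eq by blast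
  then show "A = A' \<and> B = B'"
    using \<open>src f = A\<close> \<open>tgt f = B\<close> \<open>src f' = A'\<close> \<open>tgt f' = B'\<close>
    unfolding stably_equal_def by simp
qed (auto simp: stable_simps)

section \<open>Additive structure of the stable category\<close>

lemma stable_preadditive_category: "preadditive_category S"
proof -
  interpret S: category S by (rule stable_category)
  have "comm_group (hom_group S A B)" if "A \<in> Ob S" "B \<in> Ob S" for A B
  proof (rule comm_groupI)
    show "\<exists>y\<in>carrier (hom_group S A B). y \<otimes>\<^bsub>hom_group S A B\<^esub> x = \<one>\<^bsub>hom_group S A B\<^esub>"
      if x: "x \<in> carrier (hom_group S A B)" for x
    proof -
      obtain f where f: "arr f" "src f = A" "tgt f = B" "x = stable_class f"
        using x \<open>A \<in> Ob S\<close> \<open>B \<in> Ob S\<close> by (auto simp: hom_group_def)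
      then show ?thesis using \<open>A \<in> Ob S\<close> \<open>B \<in> Ob S\<close>
        by (intro bexI [of _ "stable_class (neg f)"]) (auto simp: hom_group_def stable_simps)
    qed
  qed (use that in \<open>auto simp: hom_group_def stable_simps add_commute add_left_commute\<close>)
  then show ?thesis
    by (intro preadditive_category.intro preadditive_category_axioms.intro stable_category)
      (auto simp: stable_simps)
qed

lemma stable_additive_category: "additive_category S"
proof -
  interpret S: preadditive_category S by (rule stable_preadditive_category)
  show ?thesis
  proof
    obtain Z where "Z \<in> Ob C" "Ident C Z = Nul C Z Z"
      using ex_zero_object zero_object_iff by auto
    then have "zero_object S Z"
      unfolding S.zero_object_iff by (simp add: stable_simps)
    then show "\<exists>Z. zero_object S Z" ..
  next
    fix A B assume AB: "A \<in> Ob S" "B \<in> Ob S"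
    then obtain D i j p q where D: "biproduct C A B D i j p q"
      using ex_direct_sum [of A B] by (auto simp: is_direct_sum_def)
    have "biproduct S A B D (stable_class i) (stable_class j) (stable_class p) (stable_class q)"
      using D AB unfolding biproduct_def by (auto simp: stable_simps)
    then show "\<exists>D. is_direct_sum S A B D" unfolding is_direct_sum_def by blast
  qed
qed

sublocale S: additive_category S
  by (rule stable_additive_category)

lemma stable_arr [simp]:
  assumes "arr f"
  shows "S.arr (stable_class f)" "S.src (stable_class f) = src f" "S.tgt (stable_class f) = tgt f"
proof -
  have "stable_class f \<in> Hom S (src f) (tgt f)" using assms by auto
  then show "S.arr (stable_class f)" "S.src (stable_class f) = src f"
    "S.tgt (stable_class f) = tgt f"
    using assms by (simp_all del: stable_Hom)
qed

lemma stable_arrE: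
  assumes "S.arr F"
  obtains f where "arr f" "S.src F = src f" "S.tgt F = tgt f" "F = stable_class f"
proof -
  have ob: "S.src F \<in> Ob C" "S.tgt F \<in> Ob C"
    using S.arr_ob [OF assms] by (simp_all only: stable_Ob)
  have "F \<in> Hom S (S.src F) (S.tgt F)"
    using S.hom_iff [OF S.arr_ob(1) [OF assms] S.arr_ob(2) [OF assms]] assms by blast
  then obtain f where "f \<in> Hom C (S.src F) (S.tgt F)" "F = stable_class f"
    unfolding stable_Hom by blast
  with hom_iff [OF ob] that [of f] show ?thesis by metis
qed

lemma stable_generate:
  assumes "S.arr F" "S.arr F'" "S.src F = S.src F'" "S.tgt F = S.tgt F'"
    and eq: "\<And>x. S.arr x \<Longrightarrow> S.src x \<in> G \<Longrightarrow> S.tgt x = S.src F \<Longrightarrow> Cmp S F x = Cmp S F' x"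
  shows "F = F'"
proof -
  obtain f where f: "arr f" "F = stable_class f" using assms(1) by (rule stable_arrE)
  obtain g where g: "arr g" "F' = stable_class g" using assms(2) by (rule stable_arrE)
  have par: "src f = src g" "tgt f = tgt g" using assms(3,4) f g by auto
  have "f \<cdot> x = g \<cdot> x" if x: "arr x" "src x \<in> G" "tgt x = src g" for x
  proof (rule stably_equal_test)
    show "stably_equal (f \<cdot> x) (g \<cdot> x)"
      using eq [of "stable_class x"] f g par x by (simp add: stable_simps)
  qed (use x f par in simp)
  then show ?thesis using f g par by (simp add: stably_equal_def)
qed

section \<open>Transfer of exactness, cokernels and kernels to the stable category\<close>

lemma stable_surjective:
  assumes "arr f" "surjective_on_maps_from G f"
  shows "S.surjective_on_maps_from G (stable_class f)"
  unfolding S.surjective_on_maps_from_def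
proof (intro allI impI)
  fix y
  assume y: "S.arr y \<and> S.src y \<in> G \<and> S.tgt y = S.tgt (stable_class f)"
  then obtain z where z: "arr z" "y = stable_class z" by (blast elim: stable_arrE)
  then obtain x where "arr x" "src x = src z" "tgt x = src f" "f \<cdot> x = z"
    using y assms unfolding surjective_on_maps_from_def by auto
  then show "\<exists>x. S.arr x \<and> S.src x = S.src y \<and> S.tgt x = S.src (stable_class f) \<and>
      Cmp S (stable_class f) x = y"
    using z assms(1) by (intro exI [of _ "stable_class x"]) (auto simp: stable_simps)
qed

lemma stable_exact:
  assumes "arr f" "arr g" "tgt f = src g" "exact_on_maps_from G f g"
  shows "S.exact_on_maps_from G (stable_class f) (stable_class g)"
  unfolding S.exact_on_maps_from_def
proof (intro allI impI)
  fix y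
  assume y: "S.arr y \<and> S.src y \<in> G \<and> S.tgt y = S.src (stable_class g) \<and>
    Cmp S (stable_class g) y = Nul S (S.src y) (S.tgt (stable_class g))"
  then obtain z where z: "arr z" "y = stable_class z" by (blast elim: stable_arrE)
  then have "stably_equal (g \<cdot> z) (Nul C (src z) (tgt g))"
    using y assms by (auto simp: stable_simps)
  then have "g \<cdot> z = Nul C (src z) (tgt g)"
    by (rule stably_equal_test) (use y z assms in simp)
  then obtain x where "arr x" "src x = src z" "tgt x = src f" "f \<cdot> x = z"
    using y z assms unfolding exact_on_maps_from_def by auto
  then show "\<exists>x. S.arr x \<and> S.src x = S.src y \<and> S.tgt x = S.src (stable_class f) \<and>
      Cmp S (stable_class f) x = y"
    using z assms(1) by (intro exI [of _ "stable_class x"]) (auto simp: stable_simps)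
qed

text \<open>The assumption \<open>factor\<close> gives existence in the universal property.
  Uniqueness comes from surjectivity: a test map into \<open>tgt c\<close> lifts along
  \<open>c\<close>, so two factorizations agree on it.\<close>

lemma stable_cokernelI:
  assumes "arr f" "arr c" "src c = tgt f" "surjective_on_maps_from G c"
    and zero: "stably_equal (c \<cdot> f) (Nul C (src f) (tgt c))"
    and factor: "\<And>g. arr g \<Longrightarrow> src g = tgt f \<Longrightarrow> stably_equal (g \<cdot> f) (Nul C (src f) (tgt g)) \<Longrightarrow>
      \<exists>h. arr h \<and> src h = tgt c \<and> tgt h = tgt g \<and> stably_equal (h \<cdot> c) g"
  shows "is_cokernel S (src f) (tgt f) (stable_class f) (tgt c) (stable_class c)"
  unfolding is_cokernel_def
proof (intro conjI ballI impI)
  fix W F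
  assume W: "W \<in> Ob S" and F: "F \<in> Hom S (tgt f) W"
    and F0: "Cmp S F (stable_class f) = Nul S (src f) W"
  obtain g where g: "arr g" "src g = tgt f" "tgt g = W" "F = stable_class g"
    using W F assms(1) by auto
  have "stably_equal (g \<cdot> f) (Nul C (src f) (tgt g))"
    using F0 assms(1) g W by (simp add: stable_simps)
  then obtain h where h: "arr h" "src h = tgt c" "tgt h = tgt g" "stably_equal (h \<cdot> c) g"
    using factor g by blast
  show "\<exists>!H. H \<in> Hom S (tgt c) W \<and> Cmp S H (stable_class c) = F"
  proof (rule ex1I [of _ "stable_class h"])
    show "stable_class h \<in> Hom S (tgt c) W \<and> Cmp S (stable_class h) (stable_class c) = F"
      using h g assms(2) by (auto simp: stable_simps)
    fix K assume K: "K \<in> Hom S (tgt c) W \<and> Cmp S K (stable_class c) = F"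
    then obtain k where k: "arr k" "src k = tgt c" "tgt k = W" "K = stable_class k"
      using W assms(2) by auto
    have "stably_equal (k \<cdot> c) g"
      using K k g assms(2) by (simp add: stable_simps)
    then have kh: "stably_equal (k \<cdot> c) (h \<cdot> c)"
      using h(4) stably_equal_sym stably_equal_trans by blast
    have "k \<cdot> y = h \<cdot> y" if y: "arr y" "src y \<in> G" "tgt y = tgt c" for y
    proof -
      obtain x where x: "arr x" "src x = src y" "tgt x = src c" "c \<cdot> x = y"
        using assms(4) y unfolding surjective_on_maps_from_def by auto
      have "(k \<cdot> c) \<cdot> x = (h \<cdot> c) \<cdot> x"
        using kh x y h assms(2) unfolding stably_equal_def by auto
      then show ?thesis using x h k assms(2) by simp
    qed
    then show "K = stable_class h" using k h g by (simp add: stably_equal_def)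
  qed
qed (use assms in \<open>auto simp: stable_simps\<close>)

text \<open>Here uniqueness comes from injectivity: two factorizations agree after \<open>k\<close>
  on every test map, and \<open>k\<close> can be cancelled there.\<close>

lemma stable_kernelI:
  assumes "arr f" "arr k" "tgt k = src f" "injective_on_maps_from G k"
    and zero: "stably_equal (f \<cdot> k) (Nul C (src k) (tgt f))"
    and factor: "\<And>g. arr g \<Longrightarrow> tgt g = src f \<Longrightarrow> stably_equal (f \<cdot> g) (Nul C (src g) (tgt f)) \<Longrightarrow>
      \<exists>h. arr h \<and> src h = src g \<and> tgt h = src k \<and> stably_equal (k \<cdot> h) g"
  shows "is_kernel S (src f) (tgt f) (stable_class f) (src k) (stable_class k)"
  unfolding is_kernel_def
proof (intro conjI ballI impI)
  fix W F
  assume W: "W \<in> Ob S" and F: "F \<in> Hom S W (src f)"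
    and F0: "Cmp S (stable_class f) F = Nul S W (tgt f)"
  obtain g where g: "arr g" "src g = W" "tgt g = src f" "F = stable_class g"
    using W F assms(1) by auto
  have "stably_equal (f \<cdot> g) (Nul C (src g) (tgt f))"
    using F0 assms(1) g W by (simp add: stable_simps)
  then obtain h where h: "arr h" "src h = src g" "tgt h = src k" "stably_equal (k \<cdot> h) g"
    using factor g by blast
  show "\<exists>!H. H \<in> Hom S W (src k) \<and> Cmp S (stable_class k) H = F"
  proof (rule ex1I [of _ "stable_class h"])
    show "stable_class h \<in> Hom S W (src k) \<and> Cmp S (stable_class k) (stable_class h) = F"
      using h g assms(2) by (auto simp: stable_simps)
    fix L assume L: "L \<in> Hom S W (src k) \<and> Cmp S (stable_class k) L = F"
    then obtain l where l: "arr l" "src l = W" "tgt l = src k" "L = stable_class l"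
      using W assms(2) by auto
    have "stably_equal (k \<cdot> l) g"
      using L l g assms(2) by (simp add: stable_simps)
    then have kh: "stably_equal (k \<cdot> l) (k \<cdot> h)"
      using h(4) stably_equal_sym stably_equal_trans by blast
    have "l \<cdot> x = h \<cdot> x" if x: "arr x" "src x \<in> G" "tgt x = W" for x
    proof -
      have "(k \<cdot> l) \<cdot> x = (k \<cdot> h) \<cdot> x"
        using kh x h g assms(2) unfolding stably_equal_def by auto
      then have "k \<cdot> (l \<cdot> x) = k \<cdot> (h \<cdot> x)" using x h g l assms(2) by simp
      then show ?thesis
        using assms(4) [unfolded injective_on_maps_from_def, rule_format, of "l \<cdot> x" "h \<cdot> x"]
          x h g l by simp
    qed
    then show "L = stable_class h" using l h g by (simp add: stably_equal_def)
  qed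
qed (use assms in \<open>auto simp: stable_simps\<close>)

end

section \<open>Exactness in triangulated categories\<close>

context triangulated_category
begin

declare shift_ob [simp]

lemma arr_shift [simp]:
  assumes "arr f"
  shows "arr (Shm C f)" "src (Shm C f) = Sh C (src f)" "tgt (Shm C f) = Sh C (tgt f)"
proof -
  have "Shm C f \<in> Hom C (Sh C (src f)) (Sh C (tgt f))"
    using shift_fully_faithful [of "src f" "tgt f"] assms unfolding bij_betw_def by auto
  then show "arr (Shm C f)" "src (Shm C f) = Sh C (src f)" "tgt (Shm C f) = Sh C (tgt f)"
    using assms by auto
qed

lemma shift_cmp' [simp]:
  "arr f \<Longrightarrow> arr g \<Longrightarrow> tgt f = src g \<Longrightarrow> Shm C (g \<cdot> f) = Shm C g \<cdot> Shm C f"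
  using shift_cmp [of "src f" "tgt f" "tgt g" f g] by simp

lemma shift_faithful:
  assumes "Shm C f = Shm C g" "arr f" "arr g" "src f = src g" "tgt f = tgt g"
  shows "f = g"
  using shift_fully_faithful [of "src g" "tgt g"] assms unfolding bij_betw_def inj_on_def by simp

lemma shift_full:
  assumes "arr g" "src g = Sh C A" "tgt g = Sh C B" "A \<in> Ob C" "B \<in> Ob C"
  obtains f where "arr f" "src f = A" "tgt f = B" "Shm C f = g"
proof -
  have "g \<in> Shm C ` Hom C A B"
    using shift_fully_faithful [of A B] assms unfolding bij_betw_def by simp
  then show ?thesis using that assms(4,5) by auto
qed

lemma shift_nul [simp]:
  assumes "A \<in> Ob C" "B \<in> Ob C"
  shows "Shm C (Nul C A B) = Nul C (Sh C A) (Sh C B)"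
proof (rule add_cancel [where h = "Shm C (Nul C A B)"])
  have "Shm C (Nul C A B) \<boxplus> Shm C (Nul C A B) = Shm C (Nul C A B \<boxplus> Nul C A B)"
    using shift_add [of A B "Nul C A B" "Nul C A B"] assms by simp
  then show "Shm C (Nul C A B) \<boxplus> Shm C (Nul C A B) = Nul C (Sh C A) (Sh C B) \<boxplus> Shm C (Nul C A B)"
    using assms by simp
qed (use assms in simp_all)

lemma zero_object_shift:
  assumes "zero_object C Z"
  shows "zero_object C (Sh C Z)"
  using assms shift_ident [of Z] unfolding zero_object_iff by simp

lemma distinguished_simps:
  assumes "distinguished C A B D u v w"
  shows "A \<in> Ob C" "B \<in> Ob C" "D \<in> Ob C" "arr u" "src u = A" "tgt u = B"
    "arr v" "src v = B" "tgt v = D" "arr w" "src w = D" "tgt w = Sh C A"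
  using assms unfolding distinguished_def is_triangle_def by auto

lemma rotate:
  assumes "distinguished C A B D u v w"
  shows "distinguished C B D (Sh C A) v w (neg (Shm C u))"
  using tri_rotate [of A B D u v w] assms distinguished_simps [OF assms]
  unfolding neg_def distinguished_def by simp

text \<open>The triangle on the identity of \<open>A\<close> maps to the given one, and its third
  object is zero, so \<open>v \<cdot> u\<close> factors through zero.\<close>

lemma distinguished_cmp_nul:
  assumes T: "distinguished C A B D u v w"
  shows "v \<cdot> u = Nul C A D"
proof -
  note [simp] = distinguished_simps [OF T]
  obtain Z where Z: "zero_object C Z" using ex_zero_object by blast
  then have [simp]: "Z \<in> Ob C" unfolding zero_object_def by blast
  obtain d where d: "d \<in> Hom C Z D" "d \<cdot> Nul C A Z = v \<cdot> u"
    using tri_morphism [OF tri_ident [OF _ Z] T, of A "Ident C A" u] by auto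
  then show ?thesis by auto
qed

text \<open>The rotated identity triangle of \<open>src b\<close> maps to the rotation of the given
  triangle, with \<open>b\<close> as first component. The third component lies between shifted
  objects, so by fullness it is the shift of the desired lift; the two signs cancel.\<close>

lemma distinguished_exact:
  assumes T: "distinguished C A B D u v w"
    and b: "arr b" "tgt b = B" "v \<cdot> b = Nul C (src b) D"
  obtains a where "arr a" "src a = src b" "tgt a = A" "u \<cdot> a = b"
proof -
  note [simp] = distinguished_simps [OF T] b
  obtain Z where Z: "zero_object C Z" using ex_zero_object by blast
  then have [simp]: "Z \<in> Ob C" unfolding zero_object_def by blast
  have "distinguished C (src b) Z (Sh C (src b)) (Nul C (src b) Z) (Nul C Z (Sh C (src b)))
      (neg (Shm C (Ident C (src b))))"
    by (rule rotate [OF tri_ident]) (use Z in simp_all)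
  from tri_morphism [OF this rotate [OF T], of b "Nul C Z D"]
  obtain d where d: "arr d" "src d = Sh C (src b)" "tgt d = Sh C A"
    and eq: "Shm C b \<cdot> neg (Shm C (Ident C (src b))) = neg (Shm C u) \<cdot> d"
    by auto
  obtain a where a: "arr a" "src a = src b" "tgt a = A" "Shm C a = d"
    by (rule shift_full [of d "src b" A]) (use d in simp_all)
  have "neg (Shm C b) = neg (Shm C u \<cdot> d)"
    using eq d by (simp add: shift_ident)
  then have "Shm C (u \<cdot> a) = Shm C b"
    using a d by simp
  then have "u \<cdot> a = b"
    by (rule shift_faithful) (use a in simp_all)
  with a that show ?thesis by blast
qed

lemma distinguished_coexact:
  assumes T: "distinguished C A B D u v w"
    and g: "arr g" "src g = B" "g \<cdot> u = Nul C A (tgt g)"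
  obtains h where "arr h" "src h = D" "tgt h = tgt g" "h \<cdot> v = g"
proof -
  define W where "W = tgt g"
  have gW: "tgt g = W" "g \<cdot> u = Nul C A W" and [simp]: "W \<in> Ob C"
    using g by (simp_all add: W_def)
  note [simp] = distinguished_simps [OF T] g(1,2) gW
  obtain Z where Z: "zero_object C Z" using ex_zero_object by blast
  then have [simp]: "Z \<in> Ob C" unfolding zero_object_def by blast
  \<comment> \<open>The zero object is chosen as a shift so that this triangle is the rotation of
    one starting at \<open>Z\<close>. Rotating back gives the triangle on \<open>Z\<close>,
    \<open>W\<close>, \<open>W\<close> to which the given triangle is mapped.\<close>
  have "distinguished C W W (Sh C Z) (Ident C W) (Nul C W (Sh C Z)) (Nul C (Sh C Z) (Sh C W))"
    by (rule tri_ident) (simp_all add: zero_object_shift [OF Z])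
  moreover have "inv\<^bsub>hom_group C (Sh C Z) (Sh C W)\<^esub> (Nul C (Sh C Z) (Sh C W)) =
      Nul C (Sh C Z) (Sh C W)"
    using neg_nul [of "Sh C Z" "Sh C W"] by (simp add: neg_def)
  ultimately have "distinguished C Z W W (Nul C Z W) (Ident C W) (Nul C W (Sh C Z))"
    by (subst tri_rotate) (simp_all add: is_triangle_def)
  from tri_morphism [OF T this, of "Nul C A Z" g]
  obtain h where "h \<in> Hom C D W" "h \<cdot> v = Ident C W \<cdot> g"
    by auto
  then show ?thesis using that [of h] by simp
qed

text \<open>The weak kernel is the shift of a cone in the negative direction, which exists only up to
  isomorphism because the shift is not assumed to be invertible on the nose.\<close>

lemma ex_weak_kernel:
  assumes f [simp]: "arr f"
  obtains n where "arr n" "tgt n = src f" "f \<cdot> n = Nul C (src n) (tgt f)"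
    and "\<And>b. arr b \<Longrightarrow> tgt b = src f \<Longrightarrow> f \<cdot> b = Nul C (src b) (tgt f) \<Longrightarrow>
      \<exists>a. arr a \<and> src a = src b \<and> tgt a = src n \<and> n \<cdot> a = b"
proof -
  obtain D v w where T: "distinguished C (src f) (tgt f) D f v w"
    using tri_exists [of "src f" "tgt f" f] by auto
  note [simp] = distinguished_simps(3,7-12) [OF T]
  note T' = rotate [OF rotate [OF T]]
  obtain N s where N [simp]: "N \<in> Ob C" and s: "isomorphism C (Sh C N) D s"
    using shift_ess_surj [of D] by auto
  then obtain s' where [simp]: "arr s" "src s = Sh C N" "tgt s = D"
    "arr s'" "src s' = D" "tgt s' = Sh C N" and ss': "s \<cdot> s' = Ident C D"
    unfolding isomorphism_def by auto
  \<comment> \<open>Transporting \<open>w\<close> along \<open>s\<close> makes both ends shifted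
    objects, so fullness of the shift provides the unshifted map.\<close>
  obtain n where n [simp]: "arr n" "src n = N" "tgt n = src f" and ws: "Shm C n = w \<cdot> s"
    by (rule shift_full [of "w \<cdot> s" N "src f"]) simp_all
  have "neg (Shm C f) \<cdot> w = Nul C D (Sh C (tgt f))"
    using distinguished_cmp_nul [OF T'] .
  then have "neg (neg (Shm C f) \<cdot> w) = Nul C D (Sh C (tgt f))" by simp
  then have "Shm C f \<cdot> w = Nul C D (Sh C (tgt f))" by simp
  then have "Shm C (f \<cdot> n) = Shm C (Nul C N (tgt f))"
    by (simp add: ws assoc_eq)
  then have fn: "f \<cdot> n = Nul C N (tgt f)"
    by (rule shift_faithful) simp_all
  moreover have "\<exists>a. arr a \<and> src a = src b \<and> tgt a = src n \<and> n \<cdot> a = b"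
    if b: "arr b" "tgt b = src f" "f \<cdot> b = Nul C (src b) (tgt f)" for b
  proof -
    have "Shm C f \<cdot> Shm C b = Nul C (Sh C (src b)) (Sh C (tgt f))"
      using b shift_cmp' [of b f] by simp
    then obtain d where d: "arr d" "src d = Sh C (src b)" "tgt d = D" "w \<cdot> d = Shm C b"
      by (rule_tac distinguished_exact [OF T', of "Shm C b"])
        (use b in simp_all)
    obtain a where a: "arr a" "src a = src b" "tgt a = N" "Shm C a = s' \<cdot> d"
      by (rule shift_full [of "s' \<cdot> d" "src b" N]) (use b d in simp_all)
    have "Shm C (n \<cdot> a) = w \<cdot> (s \<cdot> (s' \<cdot> d))"
      using a d by (simp add: ws)
    also have "\<dots> = Shm C b"
      using d by (simp add: assoc_eq [OF ss'])
    finally have "n \<cdot> a = b"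
      by (rule shift_faithful) (use a b in simp_all)
    with a show ?thesis by auto
  qed
  ultimately show ?thesis using that [of n] by simp
qed

end

section \<open>The stable category of a rigid subcategory\<close>

text \<open>Approximations by \<open>X\<close> serve to describe the ideal and to build cokernels;
  approximations by the right perpendicular category serve to build weak kernels.\<close>

locale rigid_subcategory = triangulated_category +
  fixes X
  assumes X_ob: "X \<subseteq> Ob C"
    and X_finite: "contravariantly_finite C X"
    and X_rigid: "rigid C X"
    and perp_finite: "contravariantly_finite C (right_perp C X)"
begin

section \<open>Approximations and the ideal of maps through the right perpendicular category\<close>

lemma ex_approximation:
  assumes "contravariantly_finite C Y" "Y \<subseteq> Ob C" "A \<in> Ob C"
  obtains p where "arr p" "src p \<in> Y" "tgt p = A" "surjective_on_maps_from Y p"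
proof -
  obtain XA p where p: "XA \<in> Y" "p \<in> Hom C XA A"
    and im: "\<forall>X'\<in>Y. (\<lambda>h. p \<cdot> h) ` Hom C X' XA = Hom C X' A"
    using assms(1,3) unfolding contravariantly_finite_def by blast
  have XA: "XA \<in> Ob C" using p assms by blast
  then have arrp: "arr p" "src p = XA" "tgt p = A" using p assms by auto
  have "\<exists>x. arr x \<and> src x = src y \<and> tgt x = src p \<and> p \<cdot> x = y"
    if y: "arr y" "src y \<in> Y" "tgt y = tgt p" for y
  proof -
    have "y \<in> Hom C (src y) A" using y arrp assms by auto
    then have "y \<in> (\<lambda>h. p \<cdot> h) ` Hom C (src y) XA" using im y(2) by simp
    then obtain x where "x \<in> Hom C (src y) XA" "p \<cdot> x = y" by blast
    moreover have "src y \<in> Ob C" using y by simp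
    ultimately show ?thesis using arrp XA by auto
  qed
  then have "surjective_on_maps_from Y p" unfolding surjective_on_maps_from_def by blast
  then show ?thesis using that [of p] p arrp by simp
qed

lemma rigid_nul:
  assumes "arr x" "src x \<in> X" "tgt x = Sh C A" "A \<in> X"
  shows "x = Nul C (src x) (Sh C A)"
proof -
  have "x \<in> Hom C (src x) (Sh C A)" using assms X_ob by auto
  with assms X_rigid show ?thesis unfolding rigid_def by blast
qed

lemma perp_ob: "right_perp C X \<subseteq> Ob C"
  unfolding right_perp_def by blast

lemma perp_nul:
  assumes "arr x" "src x \<in> X" "tgt x \<in> right_perp C X"
  shows "x = Nul C (src x) (tgt x)"
proof -
  have "x \<in> Hom C (src x) (tgt x)" using assms by auto
  with assms show ?thesis unfolding right_perp_def by blast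
qed

text \<open>By rigidity the connecting map \<open>w\<close> kills every map from \<open>X\<close>,
  so exactness of the rotated triangle lifts such maps along \<open>v\<close>.\<close>

lemma cone_surjective:
  assumes T: "distinguished C A B D u v w" and A: "A \<in> X"
  shows "surjective_on_maps_from X v"
  unfolding surjective_on_maps_from_def
proof (intro allI impI)
  note [simp] = distinguished_simps [OF T]
  fix y assume y: "arr y \<and> src y \<in> X \<and> tgt y = tgt v"
  then have "w \<cdot> y = Nul C (src y) (Sh C A)"
    using rigid_nul [of "w \<cdot> y" A] A by simp
  then obtain b where "arr b" "src b = src y" "tgt b = B" "v \<cdot> b = y"
    by (rule_tac distinguished_exact [OF rotate [OF T], of y]) (use y in simp_all)
  then show "\<exists>x. arr x \<and> src x = src y \<and> tgt x = src v \<and> v \<cdot> x = y"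
    by auto
qed

text \<open>A map from \<open>X\<close> to the cone lifts first along \<open>v\<close> and then
  along the approximation \<open>p\<close>; it is zero because \<open>v \<cdot> p\<close>
  is.\<close>

lemma approximation_cone_perp:
  assumes T: "distinguished C A B D p v w" and A: "A \<in> X" and p: "surjective_on_maps_from X p"
  shows "D \<in> right_perp C X"
proof -
  note [simp] = distinguished_simps [OF T]
  have "y = Nul C W D" if W: "W \<in> X" "y \<in> Hom C W D" for W y
  proof -
    have [simp]: "W \<in> Ob C" using W X_ob by blast
    have y: "arr y" "src y = W" "tgt y = D" using W by auto
    obtain b where b: "arr b" "src b = W" "tgt b = B" "v \<cdot> b = y"
      using cone_surjective [OF T A] y W unfolding surjective_on_maps_from_def by auto
    obtain a where a: "arr a" "src a = W" "tgt a = A" "p \<cdot> a = b"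
      using p b W unfolding surjective_on_maps_from_def by auto
    have "v \<cdot> (p \<cdot> a) = Nul C W D"
      using a(1-3) by (simp add: assoc_eq [OF distinguished_cmp_nul [OF T]])
    then show ?thesis unfolding a(4) b(4) .
  qed
  moreover have "Nul C W D \<in> Hom C W D" if "W \<in> X" for W
    using that X_ob by auto
  ultimately have "Hom C W D = {Nul C W D}" if "W \<in> X" for W
    using that by blast
  then show ?thesis unfolding right_perp_def by simp
qed

text \<open>Maps from \<open>X\<close> into the perpendicular category vanish. Conversely, if
  \<open>f\<close> kills an approximation \<open>p\<close> of its source, it factors through the
  cone of \<open>p\<close>, which is perpendicular to \<open>X\<close>.\<close>

lemma factoring_perp_iff:
  assumes f [simp]: "arr f"
  shows "f \<in> factoring_maps C (right_perp C X) (src f) (tgt f) \<longleftrightarrow>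
    (\<forall>x. arr x \<and> src x \<in> X \<and> tgt x = src f \<longrightarrow> f \<cdot> x = Nul C (src x) (tgt f))"
proof
  assume "f \<in> factoring_maps C (right_perp C X) (src f) (tgt f)"
  then obtain W a b where W: "W \<in> right_perp C X" and fba: "f = b \<cdot> a"
    and ab: "a \<in> Hom C (src f) W" "b \<in> Hom C W (tgt f)"
    unfolding factoring_maps_def by blast
  have [simp]: "W \<in> Ob C" using W perp_ob by blast
  have a: "arr a" "src a = src f" "tgt a = W" and b: "arr b" "src b = W" "tgt b = tgt f"
    using ab by auto
  show "\<forall>x. arr x \<and> src x \<in> X \<and> tgt x = src f \<longrightarrow> f \<cdot> x = Nul C (src x) (tgt f)"
  proof (intro allI impI)
    fix x assume x: "arr x \<and> src x \<in> X \<and> tgt x = src f"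
    then have ax: "a \<cdot> x = Nul C (src x) W"
      using perp_nul [of "a \<cdot> x"] a W by simp
    have "(b \<cdot> a) \<cdot> x = b \<cdot> (a \<cdot> x)" using a b x by simp
    then have "(b \<cdot> a) \<cdot> x = Nul C (src x) (tgt f)" unfolding ax using b x by simp
    then show "f \<cdot> x = Nul C (src x) (tgt f)" using fba by simp
  qed
next
  assume *: "\<forall>x. arr x \<and> src x \<in> X \<and> tgt x = src f \<longrightarrow> f \<cdot> x = Nul C (src x) (tgt f)"
  obtain p where p: "arr p" "src p \<in> X" "tgt p = src f" "surjective_on_maps_from X p"
    by (rule ex_approximation [OF X_finite X_ob, of "src f"]) simp_all
  obtain D v w where T: "distinguished C (src p) (src f) D p v w"
    using tri_exists [of "src p" "src f" p] p by auto
  obtain h where h: "arr h" "src h = D" "tgt h = tgt f" "h \<cdot> v = f"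
    by (rule distinguished_coexact [OF T, of f]) (use * p in simp_all)
  have "D \<in> right_perp C X" using approximation_cone_perp [OF T] p by blast
  moreover have "v \<in> Hom C (src f) D" "h \<in> Hom C D (tgt f)"
    using h distinguished_simps [OF T] by auto
  ultimately show "f \<in> factoring_maps C (right_perp C X) (src f) (tgt f)"
    using h(4) unfolding factoring_maps_def by blast
qed

sublocale tested_ideal C X "right_perp C X"
  by unfold_locales (use X_ob perp_ob factoring_perp_iff in blast)+

lemma stably_nul_iff:
  assumes "arr f" "src f = A" "tgt f = B"
  shows "stably_equal f (Nul C A B) \<longleftrightarrow>
    (\<forall>x. arr x \<and> src x \<in> X \<and> tgt x = A \<longrightarrow> f \<cdot> x = Nul C (src x) B)"
proof -
  have "A \<in> Ob C" "B \<in> Ob C" using assms by auto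
  then show ?thesis using assms unfolding stably_equal_def by auto
qed

text \<open>On maps from \<open>X\<close>, the maps \<open>f\<close> and \<open>f \<cdot> p\<close>
  have the same image, so the cone of \<open>f \<cdot> p\<close> serves for \<open>f\<close>. If
  \<open>g \<cdot> f\<close> is stably zero, then \<open>g \<cdot> f \<cdot> p\<close> is zero
  outright because \<open>src p\<close> lies in \<open>X\<close>; hence \<open>g\<close> factors
  through \<open>c\<close> exactly, before passing to classes.\<close>

lemma ex_cokernel_of_approximation:
  assumes f [simp]: "arr f"
  obtains c where "arr c" "src c = tgt f" "exact_on_maps_from X f c" "surjective_on_maps_from X c"
    and "stably_equal (c \<cdot> f) (Nul C (src f) (tgt c))"
    and "\<And>g. arr g \<Longrightarrow> src g = tgt f \<Longrightarrow> stably_equal (g \<cdot> f) (Nul C (src f) (tgt g)) \<Longrightarrow>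
      \<exists>h. arr h \<and> src h = tgt c \<and> tgt h = tgt g \<and> h \<cdot> c = g"
proof -
  obtain p where p [simp]: "arr p" "tgt p = src f" and pX: "src p \<in> X"
    and sur: "surjective_on_maps_from X p"
    by (rule ex_approximation [OF X_finite X_ob, of "src f"]) simp_all
  obtain D c w where T: "distinguished C (src p) (tgt f) D (f \<cdot> p) c w"
    using tri_exists [of "src p" "tgt f" "f \<cdot> p"] by auto
  note [simp] = distinguished_simps(3,7-12) [OF T]
  have lift: "\<exists>z. arr z \<and> src z = src x \<and> tgt z = src p \<and> p \<cdot> z = x"
    if "arr x" "src x \<in> X" "tgt x = src f" for x
    using sur that unfolding surjective_on_maps_from_def by simp
  have cfp: "c \<cdot> (f \<cdot> p) = Nul C (src p) D"
    by (rule distinguished_cmp_nul [OF T])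
  have "exact_on_maps_from X f c"
    unfolding exact_on_maps_from_def
  proof (intro allI impI)
    fix y assume y: "arr y \<and> src y \<in> X \<and> tgt y = src c \<and> c \<cdot> y = Nul C (src y) (tgt c)"
    obtain a where a: "arr a" "src a = src y" "tgt a = src p" "(f \<cdot> p) \<cdot> a = y"
      by (rule distinguished_exact [OF T, of y]) (use y in simp_all)
    then show "\<exists>x. arr x \<and> src x = src y \<and> tgt x = src f \<and> f \<cdot> x = y"
      by (intro exI [of _ "p \<cdot> a"]) auto
  qed
  moreover have "stably_equal (c \<cdot> f) (Nul C (src f) D)"
  proof (subst stably_nul_iff; (intro allI impI)?)
    fix x assume x: "arr x \<and> src x \<in> X \<and> tgt x = src f"
    then obtain z where z: "arr z" "src z = src x" "tgt z = src p" "p \<cdot> z = x" using lift by blast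
    have "(c \<cdot> f) \<cdot> (p \<cdot> z) = (c \<cdot> (f \<cdot> p)) \<cdot> z" using z(1-3) by simp
    also have "\<dots> = Nul C (src x) D" unfolding cfp using z(1-3) pX X_ob by simp
    finally show "(c \<cdot> f) \<cdot> x = Nul C (src x) D" unfolding z(4) .
  qed simp_all
  moreover have "\<exists>h. arr h \<and> src h = D \<and> tgt h = tgt g \<and> h \<cdot> c = g"
    if g: "arr g" "src g = tgt f" "stably_equal (g \<cdot> f) (Nul C (src f) (tgt g))" for g
  proof -
    have "(g \<cdot> f) \<cdot> p = Nul C (src p) (tgt g)"
      using g stably_nul_iff [of "g \<cdot> f" "src f" "tgt g"] pX by simp
    then show ?thesis
      by (rule_tac distinguished_coexact [OF T, of g]) (use g in auto)
  qed
  ultimately show ?thesis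
    using that [of c] cone_surjective [OF T pX] by simp
qed

text \<open>Adding the approximation \<open>y\<close> as a second component makes room for the
  error: \<open>f \<cdot> g\<close> is stably zero exactly when \<open>y\<close> can compensate it,
  and then \<open>g\<close> lifts to a weak kernel of the combined map.\<close>

lemma ex_stable_weak_kernel:
  assumes f [simp]: "arr f"
  obtains c where "arr c" "tgt c = src f" "stably_equal (f \<cdot> c) (Nul C (src c) (tgt f))"
    and "\<And>g. arr g \<Longrightarrow> tgt g = src f \<Longrightarrow> stably_equal (f \<cdot> g) (Nul C (src g) (tgt f)) \<Longrightarrow>
      \<exists>h. arr h \<and> src h = src g \<and> tgt h = src c \<and> c \<cdot> h = g"
proof -
  obtain y where y [simp]: "arr y" "tgt y = tgt f" and yY: "src y \<in> right_perp C X"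
    and sur: "surjective_on_maps_from (right_perp C X) y"
    by (rule ex_approximation [OF perp_finite perp_ob, of "tgt f"]) simp_all
  obtain D i j p q where D: "biproduct C (src f) (src y) D i j p q"
    using ex_direct_sum [of "src f" "src y"] by (auto simp: is_direct_sum_def)
  then have [simp]: "D \<in> Ob C" unfolding biproduct_def by auto
  have [simp]: "arr i" "src i = src f" "tgt i = D" "arr j" "src j = src y" "tgt j = D"
    "arr p" "src p = D" "tgt p = src f" "arr q" "src q = D" "tgt q = src y"
    and bip [simp]: "p \<cdot> i = Ident C (src f)" "q \<cdot> j = Ident C (src y)"
    "q \<cdot> i = Nul C (src f) (src y)" "p \<cdot> j = Nul C (src y) (src f)"
    using D unfolding biproduct_def by auto
  note [simp] = bip [THEN assoc_eq]
  obtain n where n [simp]: "arr n" "tgt n = D"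
    and nul: "(f \<cdot> p \<boxplus> y \<cdot> q) \<cdot> n = Nul C (src n) (tgt f)"
    and lift: "\<And>b. arr b \<Longrightarrow> tgt b = D \<Longrightarrow> (f \<cdot> p \<boxplus> y \<cdot> q) \<cdot> b = Nul C (src b) (tgt f) \<Longrightarrow>
      \<exists>a. arr a \<and> src a = src b \<and> tgt a = src n \<and> n \<cdot> a = b"
    by (rule ex_weak_kernel [of "f \<cdot> p \<boxplus> y \<cdot> q"]) auto
  \<comment> \<open>The equation for \<open>n\<close> exhibits
    \<open>f \<cdot> (p \<cdot> n)\<close> as a map through \<open>src y\<close>, which lies in the
    perpendicular category.\<close>
  have "f \<cdot> (p \<cdot> n) = neg (y \<cdot> (q \<cdot> n))"
    by (rule neg_eqI) (use nul in simp_all)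
  then have fpn: "f \<cdot> (p \<cdot> n) = neg y \<cdot> (q \<cdot> n)" by simp
  have "f \<cdot> (p \<cdot> n) \<in> factoring_maps C (right_perp C X) (src n) (tgt f)"
    unfolding factoring_maps_def mem_Collect_eq
    by (intro exI conjI, rule fpn, rule yY) simp_all
  then have "stably_equal (f \<cdot> (p \<cdot> n)) (Nul C (src n) (tgt f))"
    using factoring_perp_iff [of "f \<cdot> (p \<cdot> n)"] stably_nul_iff [of "f \<cdot> (p \<cdot> n)" "src n" "tgt f"]
    by simp
  moreover have "\<exists>h. arr h \<and> src h = src g \<and> tgt h = src n \<and> (p \<cdot> n) \<cdot> h = g"
    if g: "arr g" "tgt g = src f" "stably_equal (f \<cdot> g) (Nul C (src g) (tgt f))" for g
  proof -
    have "f \<cdot> g \<in> factoring_maps C (right_perp C X) (src g) (tgt f)"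
      using factoring_perp_iff [of "f \<cdot> g"] stably_nul_iff [of "f \<cdot> g" "src g" "tgt f"] g by simp
    then obtain W a b where W: "W \<in> right_perp C X" and fg: "f \<cdot> g = b \<cdot> a"
      and ab: "a \<in> Hom C (src g) W" "b \<in> Hom C W (tgt f)"
      unfolding factoring_maps_def by blast
    have [simp]: "W \<in> Ob C" using W perp_ob by blast
    have a [simp]: "arr a" "src a = src g" "tgt a = W" and b [simp]: "arr b" "src b = W" "tgt b = tgt f"
      using ab g by auto
    \<comment> \<open>Any factorization of \<open>f \<cdot> g\<close> through the perpendicular
      category can be rerouted through its approximation \<open>y\<close>. The element
      \<open>(g, - t a)\<close> is then annihilated by the combined map.\<close>
    have "\<exists>t. arr t \<and> src t = W \<and> tgt t = src y \<and> y \<cdot> t = b"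
      using sur [unfolded surjective_on_maps_from_def, rule_format, of b] W by simp
    then obtain t where t [simp]: "arr t" "src t = W" "tgt t = src y" and yt: "y \<cdot> t = b"
      by blast
    have "(f \<cdot> p \<boxplus> y \<cdot> q) \<cdot> (i \<cdot> g \<boxplus> neg (j \<cdot> (t \<cdot> a))) = Nul C (src g) (tgt f)"
      using g(1,2) fg by (simp add: assoc_eq [OF yt])
    then obtain h where h: "arr h" "src h = src g" "tgt h = src n"
      "n \<cdot> h = i \<cdot> g \<boxplus> neg (j \<cdot> (t \<cdot> a))"
      using lift [of "i \<cdot> g \<boxplus> neg (j \<cdot> (t \<cdot> a))"] g(1,2) by auto
    have "(p \<cdot> n) \<cdot> h = p \<cdot> (n \<cdot> h)" using h(1-3) by simp
    also have "\<dots> = g" unfolding h(4) using g(1,2) by simp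
    finally show ?thesis using h(1-3) by blast
  qed
  ultimately show ?thesis using that [of "p \<cdot> n"] by simp
qed

text \<open>The kernel of \<open>f\<close> is the coimage of a weak kernel \<open>c\<close>, that is, the cokernel of a weak
  kernel \<open>c'\<close> of \<open>c\<close>.\<close>

lemma ex_stable_kernel:
  assumes f [simp]: "arr f"
  shows "\<exists>k. is_kernel S (src f) (tgt f) (stable_class f) (src k) (stable_class k)"
proof -
  obtain c where c [simp]: "arr c" "tgt c = src f"
    and fc: "stably_equal (f \<cdot> c) (Nul C (src c) (tgt f))"
    and c_lift: "\<And>g. arr g \<Longrightarrow> tgt g = src f \<Longrightarrow> stably_equal (f \<cdot> g) (Nul C (src g) (tgt f)) \<Longrightarrow>
      \<exists>h. arr h \<and> src h = src g \<and> tgt h = src c \<and> c \<cdot> h = g"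
    by (rule ex_stable_weak_kernel [OF f]) blast
  obtain c' where c' [simp]: "arr c'" "tgt c' = src c"
    and cc': "stably_equal (c \<cdot> c') (Nul C (src c') (tgt c))"
    and c'_lift: "\<And>g. arr g \<Longrightarrow> tgt g = src c \<Longrightarrow> stably_equal (c \<cdot> g) (Nul C (src g) (tgt c)) \<Longrightarrow>
      \<exists>h. arr h \<and> src h = src g \<and> tgt h = src c' \<and> c' \<cdot> h = g"
    by (rule ex_stable_weak_kernel [OF c(1)]) blast
  obtain e where e [simp]: "arr e" "src e = tgt c'"
    and e_sur: "surjective_on_maps_from X e"
    and ec': "stably_equal (e \<cdot> c') (Nul C (src c') (tgt e))"
    and e_factor: "\<And>g. arr g \<Longrightarrow> src g = tgt c' \<Longrightarrow> stably_equal (g \<cdot> c') (Nul C (src c') (tgt g)) \<Longrightarrow>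
      \<exists>h. arr h \<and> src h = tgt e \<and> tgt h = tgt g \<and> h \<cdot> e = g"
    by (rule ex_cokernel_of_approximation [OF c'(1)]) blast
  \<comment> \<open>Since \<open>c \<cdot> c'\<close> is stably zero, \<open>c\<close> factors
    through the cokernel \<open>e\<close> of \<open>c'\<close>. The factor \<open>m\<close> will be
    the kernel of \<open>f\<close>.\<close>
  obtain m where m [simp]: "arr m" "src m = tgt e" "tgt m = src f" and me: "m \<cdot> e = c"
    using e_factor [of c] cc' c c' by metis
  have lift: "\<exists>z. arr z \<and> src z = src x \<and> tgt z = src c \<and> e \<cdot> z = x"
    if "arr x" "src x \<in> X" "tgt x = tgt e" for x
    using e_sur that unfolding surjective_on_maps_from_def by simp
  \<comment> \<open>Lift \<open>x\<close> along \<open>e\<close> to \<open>z\<close>. Then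
    \<open>c \<cdot> z = m \<cdot> x\<close> is zero, so \<open>z\<close> comes from the weak kernel
    \<open>c'\<close>, and \<open>e\<close> kills it.\<close>
  have inj: "x = Nul C (src x) (tgt e)"
    if x: "arr x" "src x \<in> X" "tgt x = tgt e" "m \<cdot> x = Nul C (src x) (src f)" for x
  proof -
    obtain z where z: "arr z" "src z = src x" "tgt z = src c" "e \<cdot> z = x" using lift x by blast
    have "c \<cdot> z = m \<cdot> (e \<cdot> z)" using z(1-3) by (simp add: assoc_eq [OF me])
    then have "c \<cdot> z = Nul C (src z) (tgt c)" unfolding z(4) using x z by simp
    then have "stably_equal (c \<cdot> z) (Nul C (src z) (tgt c))" using z(1) by simp
    then obtain a where a: "arr a" "src a = src x" "tgt a = src c'" "c' \<cdot> a = z"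
      using c'_lift [of z] z(1-3) by metis
    have "(e \<cdot> c') \<cdot> a = Nul C (src x) (tgt e)"
      using ec' a(1-3) x stably_nul_iff [of "e \<cdot> c'" "src c'" "tgt e"] by simp
    then have "e \<cdot> (c' \<cdot> a) = Nul C (src x) (tgt e)" using a(1-3) by simp
    then show ?thesis unfolding a(4) z(4) .
  qed
  have "injective_on_maps_from X m"
    unfolding injective_on_maps_from_def
  proof (intro allI impI)
    fix x y
    assume "arr x \<and> arr y \<and> src x \<in> X \<and> src x = src y \<and> tgt x = src m \<and> tgt y = src m \<and>
      m \<cdot> x = m \<cdot> y"
    then have xy: "arr x" "arr y" "src y \<in> X" "src x = src y" "tgt x = tgt e" "tgt y = tgt e"
      "m \<cdot> x = m \<cdot> y" by auto
    then have "x \<boxplus> neg y = Nul C (src y) (tgt e)" using inj [of "x \<boxplus> neg y"] by simp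
    then show "x = y" using add_neg_eq_nul_iff [of x y] xy by simp
  qed
  \<comment> \<open>Test maps into \<open>tgt e\<close> lift along \<open>e\<close>, which reduces
    the claim to \<open>f \<cdot> c\<close>.\<close>
  moreover have "stably_equal (f \<cdot> m) (Nul C (tgt e) (tgt f))"
  proof (subst stably_nul_iff; (intro allI impI)?)
    fix x assume x: "arr x \<and> src x \<in> X \<and> tgt x = tgt e"
    then obtain z where z: "arr z" "src z = src x" "tgt z = src c" "e \<cdot> z = x" using lift by blast
    have "(f \<cdot> m) \<cdot> (e \<cdot> z) = (f \<cdot> c) \<cdot> z" using z(1-3) by (simp add: assoc_eq [OF me])
    also have "\<dots> = Nul C (src x) (tgt f)"
      using fc z x stably_nul_iff [of "f \<cdot> c" "src c" "tgt f"] by simp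
    finally show "(f \<cdot> m) \<cdot> x = Nul C (src x) (tgt f)" unfolding z(4) .
  qed simp_all
  moreover have "\<exists>h. arr h \<and> src h = src g \<and> tgt h = tgt e \<and> stably_equal (m \<cdot> h) g"
    if g: "arr g" "tgt g = src f" "stably_equal (f \<cdot> g) (Nul C (src g) (tgt f))" for g
  proof -
    obtain h where h: "arr h" "src h = src g" "tgt h = src c" "c \<cdot> h = g"
      using c_lift g by blast
    have "m \<cdot> (e \<cdot> h) = g" using h by (simp add: assoc_eq [OF me])
    then show ?thesis using h(1-3) g by (intro exI [of _ "e \<cdot> h"]) simp
  qed
  ultimately have "is_kernel S (src f) (tgt f) (stable_class f) (src m) (stable_class m)"
    by (intro stable_kernelI) simp_all
  then show ?thesis by blast
qed

text \<open>The cokernels come from triangles before passing to the quotient. Their exactness and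
  surjectivity on maps from \<open>X\<close> descend because such maps are not identified with one
  another there.\<close>

sublocale S: exact_generators S X
proof
  show "X \<subseteq> Ob S" using X_ob by simp
  show "F = F'" if "S.arr F" "S.arr F'" "S.src F = S.src F'" "S.tgt F = S.tgt F'"
    "\<And>x. S.arr x \<Longrightarrow> S.src x \<in> X \<Longrightarrow> S.tgt x = S.src F \<Longrightarrow> Cmp S F x = Cmp S F' x" for F F'
    using that by (rule stable_generate)
  fix F assume "S.arr F"
  then obtain f where f: "arr f" "S.src F = src f" "S.tgt F = tgt f" "F = stable_class f"
    by (rule stable_arrE)
  obtain c where c: "arr c" "src c = tgt f" "exact_on_maps_from X f c" "surjective_on_maps_from X c"
    "stably_equal (c \<cdot> f) (Nul C (src f) (tgt c))"
    and factor: "\<And>g. arr g \<Longrightarrow> src g = tgt f \<Longrightarrow> stably_equal (g \<cdot> f) (Nul C (src f) (tgt g)) \<Longrightarrow>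
      \<exists>h. arr h \<and> src h = tgt c \<and> tgt h = tgt g \<and> h \<cdot> c = g"
    by (rule ex_cokernel_of_approximation [OF f(1)]) blast
  have "is_cokernel S (src f) (tgt f) (stable_class f) (tgt c) (stable_class c)"
    using f(1) c(1,2,4,5)
  proof (rule stable_cokernelI)
    show "\<exists>h. arr h \<and> src h = tgt c \<and> tgt h = tgt g \<and> stably_equal (h \<cdot> c) g"
      if "arr g" "src g = tgt f" "stably_equal (g \<cdot> f) (Nul C (src f) (tgt g))" for g
      using factor [OF that] that(1) stably_equal_refl by blast
  qed
  then have "is_cokernel S (S.src F) (S.tgt F) F (S.tgt (stable_class c)) (stable_class c)"
    using f c(1) by simp
  moreover have "S.exact_on_maps_from X F (stable_class c)"
    unfolding f(4) by (rule stable_exact) (use f(1) c in simp_all)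
  moreover have "S.surjective_on_maps_from X (stable_class c)"
    by (rule stable_surjective) fact+
  ultimately show "\<exists>c. is_cokernel S (S.src F) (S.tgt F) F (S.tgt c) c \<and>
      S.exact_on_maps_from X F c \<and> S.surjective_on_maps_from X c" by blast
qed

lemma stable_semiabelian_integral: "semiabelian_category S \<and> integral_category S"
proof (rule S.semiabelian_integral)
  fix F assume "S.arr F"
  then obtain f where f: "arr f" "S.src F = src f" "S.tgt F = tgt f" "F = stable_class f"
    by (rule stable_arrE)
  obtain k where "is_kernel S (src f) (tgt f) (stable_class f) (src k) (stable_class k)"
    using ex_stable_kernel [OF f(1)] by blast
  then show "\<exists>k. is_kernel S (S.src F) (S.tgt F) F (S.src k) k"
    using f S.kernel_simps(8) by metis
qed

end

theorem proposition4p12: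
  fixes T :: "('o, 'm, 'x) tricat_scheme" and X :: "'o set"
  assumes "triangulated_category T"
    and "idempotents_split T"
    and "additive_subcategory T X"
    and "contravariantly_finite T X"
    and "rigid T X"
    and "contravariantly_finite T (right_perp T X)"
  shows "semiabelian_category (stable_category T (right_perp T X)) \<and>
         integral_category (stable_category T (right_perp T X))"
proof -
  interpret triangulated_category T by fact
  interpret rigid_subcategory T X
    by unfold_locales (use assms additive_subcategory.sub_ob in blast)+
  show ?thesis by (rule stable_semiabelian_integral)
qed

end
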